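(* Let $\mathcal{H}$ be a finite set of connected graphs with $K_t\in\mathcal{H}$ for some $t>2$, and let $s>1$ be a fixed integer. Then $\mathcal{H}$-free Edge Deletion, parameterized by $k$ and restricted to $K_{1,s}$-free input graphs, admits a polynomial kernelization.
   Context: All graphs are finite and simple. For a set of graphs $\mathcal{H}$, a graph is $\mathcal{H}$-free if it has no induced subgraph isomorphic to a member of $\mathcal{H}$. The problem $\mathcal{H}$-free Edge Deletion: given a graph $G$ and a positive integer $k$ (the parameter), decide whether there exists $E'\subseteq E(G)$ with $|E'|\le k$ such that $G\setminus E'$ is $\mathcal{H}$-free. A polynomial kernelization is a polynomial-time (in $n+k$) algorithm mapping each instance $(G,k)$ to an instance of the same problem whose size is bounded by a polynomial in $k$ and which is a yes-instance if and only if $(G,k)$ is. *)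

theory Defs
  imports "HOL-Computational_Algebra.Polynomial"
begin

section \<open>Finite simple graphs\<close>

record 'a sgraph =
  verts :: "'a set"
  edges :: "'a set set"

definition simple_graph :: "'a sgraph \<Rightarrow> bool" where
  "simple_graph G \<longleftrightarrow>
     finite (verts G) \<and> (\<forall>e\<in>edges G. e \<subseteq> verts G \<and> card e = 2)"

text \<open>The graph without vertices is not connected.\<close>

definition connected_graph :: "'a sgraph \<Rightarrow> bool" where
  "connected_graph G \<longleftrightarrow> verts G \<noteq> {} \<and>
     (\<forall>u\<in>verts G. \<forall>v\<in>verts G. (u, v) \<in> {(x, y). {x, y} \<in> edges G}\<^sup>*)"

definition induced_subgraph :: "'a sgraph \<Rightarrow> 'a set \<Rightarrow> 'a sgraph" where
  "induced_subgraph G S = \<lparr>verts = S, edges = {e \<in> edges G. e \<subseteq> S}\<rparr>"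

definition graph_iso :: "'a sgraph \<Rightarrow> 'b sgraph \<Rightarrow> bool" where
  "graph_iso G H \<longleftrightarrow>
     (\<exists>f. bij_betw f (verts G) (verts H) \<and> (\<lambda>e. f ` e) ` edges G = edges H)"

definition free_of :: "'a sgraph set \<Rightarrow> 'b sgraph \<Rightarrow> bool" where
  "free_of \<H> G \<longleftrightarrow>
     \<not> (\<exists>H\<in>\<H>. \<exists>S\<subseteq>verts G. graph_iso H (induced_subgraph G S))"

definition delete_edges :: "'a sgraph \<Rightarrow> 'a set set \<Rightarrow> 'a sgraph" where
  "delete_edges G F = \<lparr>verts = verts G, edges = edges G - F\<rparr>"

definition complete_graph :: "nat \<Rightarrow> nat sgraph" where
  "complete_graph t = \<lparr>verts = {..<t}, edges = {e. e \<subseteq> {..<t} \<and> card e = 2}\<rparr>"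

text \<open>The star $K_{1,s}$, with centre 0.\<close>

definition star_graph :: "nat \<Rightarrow> nat sgraph" where
  "star_graph s = \<lparr>verts = {0..s}, edges = {{0, i} | i. i \<in> {1..s}}\<rparr>"


section \<open>The edge deletion problem\<close>

text \<open>Input graphs have vertex set $\{0,\dots,n-1\}$, as is usual for graphs given to an
  algorithm.\<close>

definition deletion_instance :: "nat \<Rightarrow> nat sgraph \<times> nat \<Rightarrow> bool" where
  "deletion_instance s = (\<lambda>(G, k).
     simple_graph G \<and> (\<exists>n. verts G = {..<n}) \<and> free_of {star_graph s} G \<and> k > 0)"

definition deletion_yes :: "'a sgraph set \<Rightarrow> nat sgraph \<times> nat \<Rightarrow> bool" where
  "deletion_yes \<H> = (\<lambda>(G, k).
     \<exists>F\<subseteq>edges G. card F \<le> k \<and> free_of \<H> (delete_edges G F))"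


section \<open>Machine model\<close>

text \<open>Time is measured in Jones's WHILE language over binary trees, without a built-in test for
  equality of trees: every constructor, selector and test takes one unit of time. Trees can be
  represented as shared pointer structures on which each of these operations is a constant number
  of pointer operations, so polynomial time here is the same as polynomial time on Turing machines
  for all functions whose values have polynomial size.\<close>

datatype tree = Leaf | Node tree tree

datatype expr = Var nat | LeafE | NodeE expr expr | Left expr | Right expr

datatype com =
    Skip
  | Assign nat expr
  | Seq com com
  | Cond expr com com
  | While expr com

type_synonym state = "nat \<Rightarrow> tree"

primrec left :: "tree \<Rightarrow> tree" where
  "left Leaf = Leaf"
| "left (Node l r) = l"

primrec right :: "tree \<Rightarrow> tree" where
  "right Leaf = Leaf"
| "right (Node l r) = r"

primrec val :: "expr \<Rightarrow> state \<Rightarrow> tree" where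
  "val (Var x) \<sigma> = \<sigma> x"
| "val LeafE \<sigma> = Leaf"
| "val (NodeE a b) \<sigma> = Node (val a \<sigma>) (val b \<sigma>)"
| "val (Left a) \<sigma> = left (val a \<sigma>)"
| "val (Right a) \<sigma> = right (val a \<sigma>)"

primrec cost :: "expr \<Rightarrow> nat" where
  "cost (Var x) = 1"
| "cost LeafE = 1"
| "cost (NodeE a b) = cost a + cost b + 1"
| "cost (Left a) = cost a + 1"
| "cost (Right a) = cost a + 1"

text \<open>\<open>exec c \<sigma> \<tau> \<sigma>'\<close>: started in \<open>\<sigma>\<close>, the command \<open>c\<close> halts in \<open>\<sigma>'\<close> after \<open>\<tau>\<close> units of time.
  In tests, \<open>Leaf\<close> stands for false and every other tree for true.\<close>

inductive exec :: "com \<Rightarrow> state \<Rightarrow> nat \<Rightarrow> state \<Rightarrow> bool" where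
  Skip: "exec Skip \<sigma> 1 \<sigma>"
| Assign: "exec (Assign x a) \<sigma> (cost a + 1) (\<sigma>(x := val a \<sigma>))"
| Seq: "exec c \<sigma> \<tau> \<sigma>' \<Longrightarrow> exec d \<sigma>' \<tau>' \<sigma>'' \<Longrightarrow> exec (Seq c d) \<sigma> (\<tau> + \<tau>') \<sigma>''"
| Cond_True: "val a \<sigma> \<noteq> Leaf \<Longrightarrow> exec c \<sigma> \<tau> \<sigma>' \<Longrightarrow> exec (Cond a c d) \<sigma> (cost a + 1 + \<tau>) \<sigma>'"
| Cond_False: "val a \<sigma> = Leaf \<Longrightarrow> exec d \<sigma> \<tau> \<sigma>' \<Longrightarrow> exec (Cond a c d) \<sigma> (cost a + 1 + \<tau>) \<sigma>'"
| While_False: "val a \<sigma> = Leaf \<Longrightarrow> exec (While a c) \<sigma> (cost a + 1) \<sigma>"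
| While_True: "val a \<sigma> \<noteq> Leaf \<Longrightarrow> exec c \<sigma> \<tau> \<sigma>' \<Longrightarrow> exec (While a c) \<sigma>' \<tau>' \<sigma>'' \<Longrightarrow>
    exec (While a c) \<sigma> (cost a + 1 + \<tau> + \<tau>') \<sigma>''"

text \<open>Variable 0 holds the input and, in the end, the output.\<close>

definition computes :: "com \<Rightarrow> tree \<Rightarrow> nat \<Rightarrow> tree \<Rightarrow> bool" where
  "computes c x \<tau> y \<longleftrightarrow> (\<exists>\<sigma>. exec c ((\<lambda>_. Leaf)(0 := x)) \<tau> \<sigma> \<and> \<sigma> 0 = y)"


section \<open>Encoding of instances\<close>

text \<open>A graph is given by its adjacency matrix. The parameter is in unary, in accordance with
  running times being measured in terms of $n + k$.\<close>

definition enc_nat :: "nat \<Rightarrow> tree" where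
  "enc_nat n = (Node Leaf ^^ n) Leaf"

definition enc_bool :: "bool \<Rightarrow> tree" where
  "enc_bool b = (if b then Node Leaf Leaf else Leaf)"

definition enc_list :: "tree list \<Rightarrow> tree" where
  "enc_list xs = foldr Node xs Leaf"

definition enc_graph :: "nat sgraph \<Rightarrow> tree" where
  "enc_graph G =
     (let n = card (verts G) in
      enc_list (map (\<lambda>i. enc_list (map (\<lambda>j. enc_bool ({i, j} \<in> edges G)) [0..<n])) [0..<n]))"

definition enc_instance :: "nat sgraph \<times> nat \<Rightarrow> tree" where
  "enc_instance = (\<lambda>(G, k). Node (enc_nat k) (enc_graph G))"


section \<open>Kernelization\<close>

definition instance_size :: "nat sgraph \<times> nat \<Rightarrow> nat" where
  "instance_size = (\<lambda>(G, k). card (verts G) + card (edges G) + k)"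

text \<open>A parameterized graph problem is given by its instances (\<open>valid\<close>) and the yes-instances
  among them (\<open>yes\<close>).\<close>

definition polynomial_kernelization ::
  "(nat sgraph \<times> nat \<Rightarrow> bool) \<Rightarrow> (nat sgraph \<times> nat \<Rightarrow> bool) \<Rightarrow> com \<Rightarrow> bool" where
  "polynomial_kernelization valid yes c \<longleftrightarrow>
     (\<exists>p q :: nat poly. \<forall>G k. valid (G, k) \<longrightarrow>
        (\<exists>G' k' \<tau>.
           computes c (enc_instance (G, k)) \<tau> (enc_instance (G', k')) \<and>
           \<tau> \<le> poly p (card (verts G) + k) \<and>
           valid (G', k') \<and>
           instance_size (G', k') \<le> poly q k \<and>
           (yes (G', k') \<longleftrightarrow> yes (G, k))))"

definition admits_polynomial_kernelization ::
  "(nat sgraph \<times> nat \<Rightarrow> bool) \<Rightarrow> (nat sgraph \<times> nat \<Rightarrow> bool) \<Rightarrow> bool" where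
  "admits_polynomial_kernelization valid yes \<longleftrightarrow> (\<exists>c. polynomial_kernelization valid yes c)"

end

theory Submission
  imports Defs "HOL-Library.Ramsey"
begin

text \<open>Let \<open>X\<close> be the set of vertices in induced copies of members of the family \<open>\<H>\<close>, all of
  whose members have at most \<open>d\<close> vertices. As the input is $K_{1,s}$-free, Ramsey's theorem puts every
  vertex of large degree into a $K_t$ and hence into \<open>X\<close>; so outside \<open>X\<close> the degrees are bounded by
  a constant \<open>D\<close>. In a minimum deletion set, the number of edges outside the ball of radius \<open>i\<close>
  around \<open>X\<close> halves whenever \<open>i\<close> grows by \<open>2Dd\<close>: otherwise it would be cheaper to isolate the
  endpoints of the deleted edges in some shell of width \<open>d\<close> and to keep all edges beyond it.
  Hence a ball \<open>W\<close> of radius $O(\log k)$ contains every induced copy that matters, and the subgraph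
  induced by \<open>W\<close> is equivalent to the input. In a yes-instance every degree is at most \<open>D + 2k\<close> and
  \<open>X\<close> lies within distance \<open>d\<close> of the at most \<open>2k\<close> endpoints of deleted edges, so that \<open>W\<close> has
  polynomial size; a larger \<open>W\<close> certifies a no-instance. That all this is computed in polynomial time
  follows from closure properties of polynomial-time tree functions, without writing down the
  program.\<close>

section \<open>Polynomial-time tree functions\<close>

text \<open>The obstacle is that deleting edges creates new induced copies, so a solution may have
  to reach beyond \<open>X\<close>, and no constant radius is evidently enough. Connectedness limits
  each single copy to distance \<open>d\<close>, and minimality limits the whole cascade to
  logarithmic radius. That radius is affordable because a ball that already contains the neighbours
  of \<open>X\<close> grows by a factor of at most \<open>1 + D\<close> per step, and a power of
  \<open>1 + D\<close> with exponent O(log k) is polynomial in \<open>k\<close>; only the size of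
  \<open>X\<close> and the first step out of it pay for the larger degree \<open>D + 2k\<close>.
  \<open>D\<close> is a Ramsey number (cliques of size \<open>t - 1\<close> against independent sets
  of size \<open>s\<close>) plus one. Locality is applied to a minimum solution of the induced
  subgraph, not of the input: this is the direction in which equivalence could fail, and the last
  \<open>d\<close> steps of the radius are there for copies that appear around deleted edges. On the
  machine side, repetitions must not blow up intermediate trees, which is why loop bodies carry
  growth bounds and why vertex lists are always rebuilt from the full list of vertices.\<close>

lemma poly_nat_mono: "x \<le> y \<Longrightarrow> poly p x \<le> poly p y" for p :: "nat poly"
  by (induction p) (auto intro!: add_mono mult_mono)

text \<open>The start state is arbitrary, so that a program can be used inside a larger one without
  clearing its work variables. \<open>N\<close> limits the variables it may leave changed; those
  above are free for the caller.\<close>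

definition runs :: "com \<Rightarrow> nat \<Rightarrow> (tree \<Rightarrow> tree) \<Rightarrow> nat poly \<Rightarrow> bool" where
  "runs c N f p \<longleftrightarrow> (\<forall>\<sigma>. \<exists>\<tau> \<sigma>'. exec c \<sigma> \<tau> \<sigma>' \<and> \<sigma>' 0 = f (\<sigma> 0) \<and>
     (\<forall>v>N. \<sigma>' v = \<sigma> v) \<and> \<tau> \<le> poly p (size (\<sigma> 0)))"

text \<open>The size bound does not follow from the running time: assigning
  \<open>NodeE (Var x) (Var x)\<close> to \<open>x\<close> doubles a tree at constant cost.
  Composition needs it.\<close>

definition polytime :: "(tree \<Rightarrow> tree) \<Rightarrow> bool" where
  "polytime f \<longleftrightarrow> (\<exists>q. \<forall>x. size (f x) \<le> poly q (size x)) \<and> (\<exists>c N p. runs c N f p)"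

lemma runsE:
  assumes "runs c N f p"
  obtains \<tau> \<sigma>' where "exec c \<sigma> \<tau> \<sigma>'" "\<sigma>' 0 = f (\<sigma> 0)" "\<And>v. v > N \<Longrightarrow> \<sigma>' v = \<sigma> v"
    "\<tau> \<le> poly p (size (\<sigma> 0))"
  using assms unfolding runs_def by metis

lemma runs_mono: "runs c N f p \<Longrightarrow> N \<le> M \<Longrightarrow> runs c M f p"
  unfolding runs_def by (meson le_less_trans)

lemma runsI:
  assumes "\<And>\<sigma>. \<exists>\<tau> \<sigma>'. exec c \<sigma> \<tau> \<sigma>' \<and> \<sigma>' 0 = f (\<sigma> 0) \<and>
     (\<forall>v>N. \<sigma>' v = \<sigma> v) \<and> \<tau> \<le> poly p (size (\<sigma> 0))"
  shows "runs c N f p"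
  using assms unfolding runs_def by blast

lemma polytimeI:
  assumes "\<And>x. size (f x) \<le> poly q (size x)" "runs c N f p"
  shows "polytime f"
  using assms unfolding polytime_def by blast

lemma polytimeE:
  assumes "polytime f"
  obtains q c N p where "\<And>x. size (f x) \<le> poly q (size x)" "runs c N f p"
  using assms unfolding polytime_def by blast

lemma exec_Assign': "\<tau> = cost a + 1 \<Longrightarrow> \<sigma>' = \<sigma>(x := val a \<sigma>) \<Longrightarrow> exec (Assign x a) \<sigma> \<tau> \<sigma>'"
  using exec.Assign by simp

lemma polytime_id: "polytime (\<lambda>x. x)"
proof (rule polytimeI[where q = "[:0, 1:]" and p = "[:1:]"])
  show "runs Skip 0 (\<lambda>x. x) [:1:]"
    by (rule runsI) (auto intro!: exec.Skip exI)
qed simp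

primrec tree_expr :: "tree \<Rightarrow> expr" where
  "tree_expr Leaf = LeafE"
| "tree_expr (Node l r) = NodeE (tree_expr l) (tree_expr r)"

lemma val_tree_expr: "val (tree_expr t) \<sigma> = t"
  by (induction t) auto

lemma polytime_const: "polytime (\<lambda>x. t)"
proof (rule polytimeI[where q = "[:size t:]"])
  show "runs (Assign 0 (tree_expr t)) 0 (\<lambda>x. t) [:cost (tree_expr t) + 1:]"
    by (rule runsI) (auto intro!: exec_Assign' exI simp: val_tree_expr)
qed simp

lemma polytime_comp:
  assumes "polytime g" "polytime f"
  shows "polytime (\<lambda>x. g (f x))"
proof -
  obtain qf cf Nf pf where f: "\<And>x. size (f x) \<le> poly qf (size x)" "runs cf Nf f pf"
    using polytimeE[OF assms(2)] by metis
  obtain qg cg Ng pg where g: "\<And>x. size (g x) \<le> poly qg (size x)" "runs cg Ng g pg"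
    using polytimeE[OF assms(1)] by metis
  show ?thesis
  proof (rule polytimeI)
    fix x
    show "size (g (f x)) \<le> poly (pcompose qg qf) (size x)"
      using g(1)[of "f x"] poly_nat_mono[OF f(1), of qg x] by (simp add: poly_pcompose)
  next
    show "runs (Seq cf cg) (max Nf Ng) (\<lambda>x. g (f x)) (pf + pcompose pg qf)"
    proof (rule runsI)
      fix \<sigma>
      obtain \<tau> \<sigma>' where 1: "exec cf \<sigma> \<tau> \<sigma>'" "\<sigma>' 0 = f (\<sigma> 0)" "\<And>v. v > Nf \<Longrightarrow> \<sigma>' v = \<sigma> v"
        "\<tau> \<le> poly pf (size (\<sigma> 0))" using runsE[OF f(2), of \<sigma>] by blast
      obtain \<tau>' \<sigma>'' where 2: "exec cg \<sigma>' \<tau>' \<sigma>''" "\<sigma>'' 0 = g (\<sigma>' 0)"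
        "\<And>v. v > Ng \<Longrightarrow> \<sigma>'' v = \<sigma>' v" "\<tau>' \<le> poly pg (size (\<sigma>' 0))" using runsE[OF g(2), of \<sigma>'] by blast
      have "\<tau>' \<le> poly pg (poly qf (size (\<sigma> 0)))"
        using 2(4) poly_nat_mono[OF f(1), of pg "\<sigma> 0"] 1(2) by simp
      then show "\<exists>\<tau> \<sigma>'. exec (Seq cf cg) \<sigma> \<tau> \<sigma>' \<and> \<sigma>' 0 = g (f (\<sigma> 0)) \<and>
         (\<forall>v>max Nf Ng. \<sigma>' v = \<sigma> v) \<and> \<tau> \<le> poly (pf + pcompose pg qf) (size (\<sigma> 0))"
        using 1 2 by (intro exI[of _ "\<tau> + \<tau>'"] exI[of _ \<sigma>''])
          (auto intro: exec.Seq simp: poly_pcompose)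
    qed
  qed
qed

lemma size_left_le: "size (left t) \<le> size t" and size_right_le: "size (right t) \<le> size t"
  by (cases t; simp)+

lemma polytime_left: "polytime f \<Longrightarrow> polytime (\<lambda>x. left (f x))"
proof (rule polytime_comp[where g = left], rule polytimeI[where q = "[:0, 1:]"])
  show "runs (Assign 0 (Left (Var 0))) 0 left [:3:]"
    by (rule runsI) (auto intro!: exec_Assign' exI)
qed (auto simp: size_left_le)

lemma polytime_right: "polytime f \<Longrightarrow> polytime (\<lambda>x. right (f x))"
proof (rule polytime_comp[where g = right], rule polytimeI[where q = "[:0, 1:]"])
  show "runs (Assign 0 (Right (Var 0))) 0 right [:3:]"
    by (rule runsI) (auto intro!: exec_Assign' exI)
qed (auto simp: size_right_le)

lemma polytime_Node:
  assumes "polytime f" "polytime g"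
  shows "polytime (\<lambda>x. Node (f x) (g x))"
proof -
  obtain qf cf Nf pf where f: "\<And>x. size (f x) \<le> poly qf (size x)" "runs cf Nf f pf"
    using polytimeE[OF assms(1)] by metis
  obtain qg cg Ng pg where g: "\<And>x. size (g x) \<le> poly qg (size x)" "runs cg Ng g pg"
    using polytimeE[OF assms(2)] by metis
  define M where "M = max Nf Ng"
  have rf: "runs cf M f pf" and rg: "runs cg M g pg"
    using f(2) g(2) by (auto simp: M_def intro: runs_mono)
  \<comment> \<open>\<open>M+1\<close> saves the input for the second program and \<open>M+2\<close>
    the first result; both lie above all variables that either program changes.\<close>
  let ?c = "Seq (Assign (M+1) (Var 0)) (Seq cf (Seq (Assign (M+2) (Var 0))
    (Seq (Assign 0 (Var (M+1))) (Seq cg (Assign 0 (NodeE (Var (M+2)) (Var 0)))))))"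
  show ?thesis
  proof (rule polytimeI)
    show "size (Node (f x) (g x)) \<le> poly (qf + qg + [:1:]) (size x)" for x
      using f(1)[of x] g(1)[of x] by simp
    show "runs ?c (M+2) (\<lambda>x. Node (f x) (g x)) (pf + pg + [:10:])"
    proof (rule runsI)
      fix \<sigma> :: state
      let ?s1 = "\<sigma>(M+1 := \<sigma> 0)"
      obtain \<tau> s2 where 1: "exec cf ?s1 \<tau> s2" "s2 0 = f (?s1 0)" "\<And>v. v > M \<Longrightarrow> s2 v = ?s1 v"
        "\<tau> \<le> poly pf (size (?s1 0))" using runsE[OF rf, of ?s1] by blast
      let ?s3 = "s2(M+2 := s2 0, 0 := s2 (M+1))"
      obtain \<tau>' s4 where 2: "exec cg ?s3 \<tau>' s4" "s4 0 = g (?s3 0)"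
        "\<And>v. v > M \<Longrightarrow> s4 v = ?s3 v" "\<tau>' \<le> poly pg (size (?s3 0))" using runsE[OF rg, of ?s3] by blast
      let ?s5 = "s4(0 := Node (s4 (M+2)) (s4 0))"
      have "exec ?c \<sigma> (2 + (\<tau> + (2 + (2 + (\<tau>' + 4))))) ?s5"
        by (rule exec.Seq[OF exec_Assign' exec.Seq[OF 1(1) exec.Seq[OF exec_Assign'[OF _ refl]
          exec.Seq[OF exec_Assign' exec.Seq[OF 2(1) exec_Assign']]]]]) (simp_all add: fun_eq_iff)
      then show "\<exists>\<tau> \<sigma>'. exec ?c \<sigma> \<tau> \<sigma>' \<and> \<sigma>' 0 = Node (f (\<sigma> 0)) (g (\<sigma> 0)) \<and>
         (\<forall>v>M+2. \<sigma>' v = \<sigma> v) \<and> \<tau> \<le> poly (pf + pg + [:10:]) (size (\<sigma> 0))"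
        using 1 2 by (intro exI[of _ "2 + (\<tau> + (2 + (2 + (\<tau>' + 4))))"] exI[of _ ?s5]) auto
    qed
  qed
qed

lemma polytime_cond:
  assumes "polytime f" "polytime g" "polytime h"
  shows "polytime (\<lambda>x. if f x \<noteq> Leaf then g x else h x)"
proof -
  obtain qf cf Nf pf where f: "\<And>x. size (f x) \<le> poly qf (size x)" "runs cf Nf f pf"
    using polytimeE[OF assms(1)] by metis
  obtain qg cg Ng pg where g: "\<And>x. size (g x) \<le> poly qg (size x)" "runs cg Ng g pg"
    using polytimeE[OF assms(2)] by metis
  obtain qh ch Nh ph where h: "\<And>x. size (h x) \<le> poly qh (size x)" "runs ch Nh h ph"
    using polytimeE[OF assms(3)] by metis
  define M where "M = max Nf (max Ng Nh)"
  have rf: "runs cf M f pf" and rg: "runs cg M g pg" and rh: "runs ch M h ph"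
    using f(2) g(2) h(2) by (auto simp: M_def intro: runs_mono)
  let ?c = "Seq (Assign (M+1) (Var 0)) (Seq cf (Seq (Assign (M+2) (Var 0))
    (Seq (Assign 0 (Var (M+1))) (Cond (Var (M+2)) cg ch))))"
  let ?F = "\<lambda>x. if f x \<noteq> Leaf then g x else h x"
  show ?thesis
  proof (rule polytimeI)
    show "size (?F x) \<le> poly (qg + qh) (size x)" for x
      using g(1)[of x] h(1)[of x] by simp
    show "runs ?c (M+2) ?F (pf + pg + ph + [:10:])"
    proof (rule runsI)
      fix \<sigma> :: state
      let ?s1 = "\<sigma>(M+1 := \<sigma> 0)"
      obtain \<tau> s2 where 1: "exec cf ?s1 \<tau> s2" "s2 0 = f (?s1 0)" "\<And>v. v > M \<Longrightarrow> s2 v = ?s1 v"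
        "\<tau> \<le> poly pf (size (?s1 0))" using runsE[OF rf, of ?s1] by blast
      let ?s3 = "s2(M+2 := s2 0, 0 := s2 (M+1))"
      have "\<exists>\<tau>' s4. exec (Cond (Var (M+2)) cg ch) ?s3 \<tau>' s4 \<and> s4 0 = ?F (\<sigma> 0) \<and>
          (\<forall>v>M. s4 v = ?s3 v) \<and> \<tau>' \<le> 2 + poly (pg + ph) (size (\<sigma> 0))"
      proof (cases "f (\<sigma> 0) = Leaf")
        case True
        obtain \<tau>' s4 where 2: "exec ch ?s3 \<tau>' s4" "s4 0 = h (?s3 0)"
          "\<And>v. v > M \<Longrightarrow> s4 v = ?s3 v" "\<tau>' \<le> poly ph (size (?s3 0))" using runsE[OF rh, of ?s3] by blast
        show ?thesis
          using exec.Cond_False[of "Var (M+2)", OF _ 2(1), of cg] True 1 2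
          by (intro exI[of _ "cost (Var (M+2)) + 1 + \<tau>'"] exI[of _ s4]) auto
      next
        case False
        obtain \<tau>' s4 where 2: "exec cg ?s3 \<tau>' s4" "s4 0 = g (?s3 0)"
          "\<And>v. v > M \<Longrightarrow> s4 v = ?s3 v" "\<tau>' \<le> poly pg (size (?s3 0))" using runsE[OF rg, of ?s3] by blast
        show ?thesis
          using exec.Cond_True[of "Var (M+2)", OF _ 2(1), of ch] False 1 2
          by (intro exI[of _ "cost (Var (M+2)) + 1 + \<tau>'"] exI[of _ s4]) auto
      qed
      then obtain \<tau>' s4 where 2: "exec (Cond (Var (M+2)) cg ch) ?s3 \<tau>' s4" "s4 0 = ?F (\<sigma> 0)"
          "\<forall>v>M. s4 v = ?s3 v" "\<tau>' \<le> 2 + poly (pg + ph) (size (\<sigma> 0))" by blast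
      have "exec ?c \<sigma> (2 + (\<tau> + (2 + (2 + \<tau>')))) s4"
        by (rule exec.Seq[OF exec_Assign' exec.Seq[OF 1(1) exec.Seq[OF exec_Assign'[OF _ refl]
          exec.Seq[OF exec_Assign' 2(1)]]]]) (simp_all add: fun_eq_iff)
      then show "\<exists>\<tau> \<sigma>'. exec ?c \<sigma> \<tau> \<sigma>' \<and> \<sigma>' 0 = ?F (\<sigma> 0) \<and>
         (\<forall>v>M+2. \<sigma>' v = \<sigma> v) \<and> \<tau> \<le> poly (pf + pg + ph + [:10:]) (size (\<sigma> 0))"
        using 1 2 by (intro exI[of _ "2 + (\<tau> + (2 + (2 + \<tau>')))"] exI[of _ s4]) auto
    qed
  qed
qed

section \<open>Loops over encoded lists\<close>

primrec dec_list :: "tree \<Rightarrow> tree list" where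
  "dec_list Leaf = []"
| "dec_list (Node a b) = a # dec_list b"

lemma enc_list_simps [simp]: "enc_list [] = Leaf" "enc_list (x # xs) = Node x (enc_list xs)"
  by (auto simp: enc_list_def)

lemma dec_enc_list [simp]: "dec_list (enc_list xs) = xs"
  by (induction xs) auto

lemma enc_dec_list [simp]: "enc_list (dec_list t) = t"
  by (induction t) auto

lemma length_dec_list_le: "length (dec_list t) \<le> size t"
  by (induction t) auto

text \<open>The bound on the growth of the accumulator is additive, so that its size stays polynomial
  over all iterations.\<close>

lemma polytime_fold_basic:
  assumes "polytime h"
    and grow: "\<And>c e a. size (h (Node c (Node e a))) \<le> size a + poly b (size c + size e)"
  shows "polytime (\<lambda>y. fold (\<lambda>e a. h (Node (left y) (Node e a))) (dec_list (left (right y)))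
    (right (right y)))"
proof -
  obtain q c M p where h: "\<And>x. size (h x) \<le> poly q (size x)" "runs c M h p"
    using polytimeE[OF assms(1)] by metis
  \<comment> \<open>\<open>M+1\<close> holds the fixed context, \<open>M+2\<close> the list still to
    be read and \<open>M+3\<close> the accumulator.\<close>
  let ?body = "Seq (Assign 0 (NodeE (Var (M+1)) (NodeE (Left (Var (M+2))) (Var (M+3)))))
     (Seq c (Seq (Assign (M+3) (Var 0)) (Assign (M+2) (Right (Var (M+2))))))"
  let ?while = "While (Var (M+2)) ?body"
  have size_fold: "size (fold (\<lambda>e a. h (Node x (Node e a))) (dec_list l) a) \<le>
      size a + length (dec_list l) * B"
    if "B = poly b (size x + L)" "size l \<le> L" for x l a B L
    using that(2)
  proof (induction l arbitrary: a)
    case (Node e l)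
    have "size (h (Node x (Node e a))) \<le> size a + B"
      using grow[of x e a] poly_nat_mono[of "size x + size e" "size x + L" b] Node.prems that(1)
      by simp
    then show ?case using Node.IH(2)[of "h (Node x (Node e a))"] Node.prems by simp
  qed simp
  \<comment> \<open>\<open>L\<close>, \<open>B\<close> and \<open>S\<close> stay fixed in the
    induction. The invariant that the accumulator plus all growth still to come is at most
    \<open>S\<close> bounds every accumulator, and so the cost of every round.\<close>
  have loop: "\<exists>\<tau> \<sigma>'. exec ?while \<sigma> \<tau> \<sigma>' \<and>
      \<sigma>' (M+3) = fold (\<lambda>e a. h (Node x (Node e a))) (dec_list l) a \<and>
      (\<forall>v>M+3. \<sigma>' v = \<sigma> v) \<and> \<tau> \<le> length (dec_list l) * (poly p (size x + L + S + 2) + 20) + 2"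
    if "\<sigma> (M+1) = x" "\<sigma> (M+2) = l" "\<sigma> (M+3) = a" "B = poly b (size x + L)" "size l \<le> L"
       "size a + length (dec_list l) * B \<le> S" for x l a \<sigma> L B S
    using that
  proof (induction l arbitrary: a \<sigma>)
    case Leaf
    then have "exec ?while \<sigma> (cost (Var (M+2)) + 1) \<sigma>" by (intro exec.While_False) simp
    with Leaf show ?case by (intro exI[of _ "cost (Var (M+2)) + 1"] exI[of _ \<sigma>]) auto
  next
    case (Node e l)
    let ?s1 = "\<sigma>(0 := Node x (Node e a))"
    obtain \<tau> s2 where 1: "exec c ?s1 \<tau> s2" "s2 0 = h (?s1 0)" "\<And>v. v > M \<Longrightarrow> s2 v = ?s1 v"
      "\<tau> \<le> poly p (size (?s1 0))" using runsE[OF h(2), of ?s1] by blast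
    let ?s3 = "s2(M+3 := s2 0, M+2 := l)"
    have body: "exec ?body \<sigma> (7 + (\<tau> + (2 + 3))) ?s3"
      by (rule exec.Seq[OF exec_Assign' exec.Seq[OF 1(1) exec.Seq[OF exec_Assign'[OF _ refl] exec_Assign']]])
        (use Node.prems 1 in \<open>simp_all add: fun_eq_iff\<close>)
    have "size (h (Node x (Node e a))) \<le> size a + B"
      using grow[of x e a] poly_nat_mono[of "size x + size e" "size x + L" b] Node.prems by simp
    then have "size (h (Node x (Node e a))) + length (dec_list l) * B \<le> S"
      using Node.prems(6) by simp
    then have "\<exists>\<tau> \<sigma>'. exec ?while ?s3 \<tau> \<sigma>' \<and>
      \<sigma>' (M+3) = fold (\<lambda>e a. h (Node x (Node e a))) (dec_list l) (h (Node x (Node e a))) \<and>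
      (\<forall>v>M+3. \<sigma>' v = ?s3 v) \<and>
      \<tau> \<le> length (dec_list l) * (poly p (size x + L + S + 2) + 20) + 2"
      by (intro Node.IH(2)[OF _ _ _ Node.prems(4)]) (use Node.prems 1 in simp_all)
    then obtain \<tau>' s4 where 2: "exec ?while ?s3 \<tau>' s4"
      "s4 (M+3) = fold (\<lambda>e a. h (Node x (Node e a))) (dec_list l) (h (Node x (Node e a)))"
      "\<forall>v>M+3. s4 v = ?s3 v"
      "\<tau>' \<le> length (dec_list l) * (poly p (size x + L + S + 2) + 20) + 2"
      by blast
    have "\<tau> \<le> poly p (size x + L + S + 2)"
      using 1(4) Node.prems(5,6) poly_nat_mono[of "size (?s1 0)" "size x + L + S + 2" p] by simp
    moreover have "exec ?while \<sigma> (cost (Var (M+2)) + 1 + (7 + (\<tau> + (2 + 3))) + \<tau>') s4"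
      using Node.prems(2) by (intro exec.While_True[OF _ body 2(1)]) simp
    ultimately show ?case
      using 1 2 Node.prems
      by (intro exI[of _ "cost (Var (M+2)) + 1 + (7 + (\<tau> + (2 + 3))) + \<tau>'"] exI[of _ s4]) auto
  qed
  let ?F = "\<lambda>y. fold (\<lambda>e a. h (Node (left y) (Node e a))) (dec_list (left (right y)))
    (right (right y))"
  let ?X = "[:0, 1:] :: nat poly"
  let ?S = "?X + ?X * b"
  let ?c = "Seq (Assign (M+1) (Left (Var 0))) (Seq (Assign (M+2) (Left (Right (Var 0))))
    (Seq (Assign (M+3) (Right (Right (Var 0)))) (Seq ?while (Assign 0 (Var (M+3))))))"
  have S: "size (right (right y)) + length (dec_list (left (right y))) *
        poly b (size (left y) + size (left (right y))) \<le> poly ?S (size y)" for y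
  proof -
    have "size (left y) + size (left (right y)) \<le> size y"
      by (cases y) (auto simp: size_left_le le_SucI)
    moreover have "length (dec_list (left (right y))) \<le> size y" "size (right (right y)) \<le> size y"
      using length_dec_list_le[of "left (right y)"] size_left_le[of "right y"] size_right_le[of y]
        size_right_le[of "right y"] by linarith+
    ultimately show ?thesis by (auto intro!: add_mono mult_mono poly_nat_mono)
  qed
  show ?thesis
  proof (rule polytimeI)
    show "size (?F y) \<le> poly ?S (size y)" for y
      using size_fold[OF refl le_refl, of "left y" "left (right y)" "right (right y)"] S[of y] by simp
    show "runs ?c (M+3) ?F (?X * (pcompose p (?X + ?S + [:2:]) + [:20:]) + [:20:])"
    proof (rule runsI)
      fix \<sigma> :: state
      define y where "y = \<sigma> 0"
      let ?s1 = "\<sigma>(M+1 := left y, M+2 := left (right y), M+3 := right (right y))"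
      let ?t = "length (dec_list (left (right y))) *
         (poly p (size (left y) + size (left (right y)) + poly ?S (size y) + 2) + 20) + 2"
      obtain \<tau> s2 where 1: "exec ?while ?s1 \<tau> s2" "s2 (M+3) = ?F y" "\<forall>v>M+3. s2 v = ?s1 v" "\<tau> \<le> ?t"
        using loop[OF _ _ _ refl le_refl S[of y], of ?s1] by auto
      let ?s3 = "s2(0 := s2 (M+3))"
      have "exec ?c \<sigma> (3 + (4 + (4 + (\<tau> + 2)))) ?s3"
        by (rule exec.Seq[OF exec_Assign'[OF _ refl] exec.Seq[OF exec_Assign'[OF _ refl]
          exec.Seq[OF exec_Assign'
          exec.Seq[OF 1(1) exec_Assign']]]]) (simp_all add: y_def fun_eq_iff)
      moreover have "size (left y) + size (left (right y)) \<le> size y"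
        by (cases y) (auto simp: size_left_le le_SucI)
      moreover have "length (dec_list (left (right y))) \<le> size y"
        using length_dec_list_le[of "left (right y)"] size_left_le[of "right y"] size_right_le[of y]
        by linarith
      ultimately have "?t \<le> size y * (poly p (size y + poly ?S (size y) + 2) + 20) + 2"
        by (intro add_mono mult_mono poly_nat_mono) auto
      with 1 have "\<tau> \<le> size y * (poly p (size y + poly ?S (size y) + 2) + 20) + 2" by simp
      with \<open>exec ?c \<sigma> (3 + (4 + (4 + (\<tau> + 2)))) ?s3\<close>
      show "\<exists>\<tau> \<sigma>'. exec ?c \<sigma> \<tau> \<sigma>' \<and> \<sigma>' 0 = ?F (\<sigma> 0) \<and>
         (\<forall>v>M+3. \<sigma>' v = \<sigma> v) \<and>
         \<tau> \<le> poly (?X * (pcompose p (?X + ?S + [:2:]) + [:20:]) + [:20:]) (size (\<sigma> 0))"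
        using 1 unfolding y_def
        by (intro exI[of _ "3 + (4 + (4 + (\<tau> + 2)))"] exI[of _ ?s3]) (simp add: poly_pcompose)
    qed
  qed
qed

text \<open>The input \<open>x\<close> itself serves as context, which is how data computed from
  \<open>x\<close> reaches the loop body. In the first premise the tree \<open>y\<close> codes
  context, element and accumulator as \<open>Node c (Node e a)\<close>.\<close>

lemma polytime_fold:
  assumes "polytime (\<lambda>y. h (left y) (left (right y)) (right (right y)))" "polytime f" "polytime g"
    and "\<And>c e a. size (h c e a) \<le> size a + poly b (size c + size e)"
  shows "polytime (\<lambda>x. fold (h x) (dec_list (f x)) (g x))"
  using polytime_comp[OF polytime_fold_basic[OF assms(1), of b]
      polytime_Node[OF polytime_id polytime_Node[OF assms(2,3)]]] assms(4)
  by simp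

section \<open>Tests, lists and unary numbers\<close>

definition ptest :: "(tree \<Rightarrow> bool) \<Rightarrow> bool" where
  "ptest P \<longleftrightarrow> polytime (\<lambda>x. enc_bool (P x))"

definition polylist :: "(tree \<Rightarrow> tree list) \<Rightarrow> bool" where
  "polylist f \<longleftrightarrow> polytime (\<lambda>x. enc_list (f x))"

definition polynat :: "(tree \<Rightarrow> nat) \<Rightarrow> bool" where
  "polynat f \<longleftrightarrow> polytime (\<lambda>x. enc_nat (f x))"

definition polynats :: "(tree \<Rightarrow> nat list) \<Rightarrow> bool" where
  "polynats f \<longleftrightarrow> polytime (\<lambda>x. enc_list (map enc_nat (f x)))"

text \<open>A left inverse of \<open>enc_nat\<close> that is total on trees, so that the closure
  lemmas need no premises on well-formed codes.\<close>

definition len :: "tree \<Rightarrow> nat" where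
  "len t = length (dec_list t)"

definition lens :: "tree \<Rightarrow> nat list" where
  "lens t = map len (dec_list t)"

lemma enc_nat_simps [simp]: "enc_nat 0 = Leaf" "enc_nat (Suc n) = Node Leaf (enc_nat n)"
  by (auto simp: enc_nat_def)

lemma dec_list_enc_nat: "dec_list (enc_nat n) = replicate n Leaf"
  by (induction n) auto

lemma len_enc_nat [simp]: "len (enc_nat n) = n"
  by (simp add: len_def dec_list_enc_nat)

lemma len_Leaf [simp]: "len Leaf = 0"
  by (simp add: len_def)

lemma lens_enc_nats [simp]: "lens (enc_list (map enc_nat xs)) = xs"
  by (simp add: lens_def comp_def)

lemma size_enc_nat [simp]: "size (enc_nat n) = n"
  by (induction n) auto

lemma len_le_size: "len t \<le> size t"
  by (simp add: len_def length_dec_list_le)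

lemma enc_nat_eq_enc_list: "enc_nat n = enc_list (replicate n Leaf)"
  by (induction n) auto

lemma polytime_bound: "polytime f \<Longrightarrow> \<exists>q. \<forall>x. size (f x) \<le> poly q (size x)"
  by (auto simp: polytime_def)

lemma polytime_if:
  assumes "ptest P" "polytime f" "polytime g"
  shows "polytime (\<lambda>x. if P x then f x else g x)"
  using polytime_cond[OF assms(1)[unfolded ptest_def] assms(2,3)]
  by (rule back_subst[of polytime]) (auto simp: enc_bool_def)

lemma ptest_nonleaf: "polytime f \<Longrightarrow> ptest (\<lambda>x. f x \<noteq> Leaf)"
  unfolding ptest_def enc_bool_def by (intro polytime_cond polytime_const)

lemma ptest_const: "ptest (\<lambda>x. b)"
  unfolding ptest_def by (rule polytime_const)

lemma ptest_if: "ptest P \<Longrightarrow> ptest Q \<Longrightarrow> ptest R \<Longrightarrow> ptest (\<lambda>x. if P x then Q x else R x)"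
  unfolding ptest_def if_distrib[of enc_bool]
  by (intro polytime_if) (auto simp: ptest_def)

lemma ptest_not: "ptest P \<Longrightarrow> ptest (\<lambda>x. \<not> P x)"
  using ptest_if[OF _ ptest_const[of False] ptest_const[of True], of P]
  by (rule back_subst[of ptest]) (auto simp: fun_eq_iff)

lemma ptest_conj: "ptest P \<Longrightarrow> ptest Q \<Longrightarrow> ptest (\<lambda>x. P x \<and> Q x)"
  using ptest_if[of P Q, OF _ _ ptest_const[of False]]
  by (rule back_subst[of ptest]) (auto simp: fun_eq_iff)

lemma ptest_disj: "ptest P \<Longrightarrow> ptest Q \<Longrightarrow> ptest (\<lambda>x. P x \<or> Q x)"
  using ptest_if[of P, OF _ ptest_const[of True], of Q]
  by (rule back_subst[of ptest]) (auto simp: fun_eq_iff)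

lemma ptest_imp: "ptest P \<Longrightarrow> ptest Q \<Longrightarrow> ptest (\<lambda>x. P x \<longrightarrow> Q x)"
  using ptest_if[of P Q, OF _ _ ptest_const[of True]]
  by (rule back_subst[of ptest]) (auto simp: fun_eq_iff)

lemma ptest_iff: "ptest P \<Longrightarrow> ptest Q \<Longrightarrow> ptest (\<lambda>x. P x \<longleftrightarrow> Q x)"
  using ptest_if[of P Q, OF _ _ ptest_not[of Q]]
  by (rule back_subst[of ptest]) (auto simp: fun_eq_iff)

lemma ptest_comp: "ptest P \<Longrightarrow> polytime f \<Longrightarrow> ptest (\<lambda>x. P (f x))"
  unfolding ptest_def by (rule polytime_comp)

text \<open>The bound is a constant, so each \<open>P i\<close> may have a program of its own; no
  uniformity in \<open>i\<close> is needed.\<close>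

lemma ptest_all_const: "(\<And>i. i < m \<Longrightarrow> ptest (P i)) \<Longrightarrow> ptest (\<lambda>x. \<forall>i<m. P i x)" for m :: nat
proof (induction m)
  case (Suc m)
  then have "ptest (\<lambda>x. (\<forall>i<m. P i x) \<and> P m x)" by (intro ptest_conj) auto
  then show ?case by (rule back_subst[of ptest]) (auto simp: fun_eq_iff less_Suc_eq)
qed (simp add: ptest_const)

lemma ptest_ex_const: "(\<And>i. i < m \<Longrightarrow> ptest (P i)) \<Longrightarrow> ptest (\<lambda>x. \<exists>i<m. P i x)" for m :: nat
  using ptest_not[OF ptest_all_const[of m "\<lambda>i x. \<not> P i x"]] ptest_not by simp

lemma polylist_dec: "polytime f \<Longrightarrow> polylist (\<lambda>x. dec_list (f x))"
  by (simp add: polylist_def)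

lemma ptest_bex:
  assumes "ptest (\<lambda>y. P (left y) (right y))" "polylist f"
  shows "ptest (\<lambda>x. \<exists>e\<in>set (f x). P x e)"
proof -
  have *: "fold (\<lambda>e a. if P x e then Node Leaf Leaf else a) xs a =
      (if \<exists>e\<in>set xs. P x e then Node Leaf Leaf else a)" for x xs a
    by (induction xs arbitrary: a) auto
  have "ptest (\<lambda>y. P (left y) (left (right y)))"
    using ptest_comp[OF assms(1), of "\<lambda>y. Node (left y) (left (right y))"]
    by (simp add: polytime_Node polytime_left polytime_right polytime_id)
  then have "polytime (\<lambda>x. fold (\<lambda>e a. if P x e then Node Leaf Leaf else a)
      (dec_list (enc_list (f x))) Leaf)"
    using assms(2) unfolding polylist_def
    by (intro polytime_fold[where b = "[:1:]"] polytime_if polytime_const polytime_right polytime_id)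
      auto
  then show ?thesis unfolding * by (simp add: ptest_def enc_bool_def)
qed

lemma polylist_rev:
  assumes "polylist f"
  shows "polylist (\<lambda>x. rev (f x))"
proof -
  have *: "fold Node xs (enc_list ys) = enc_list (rev xs @ ys)" for xs ys
    by (induction xs arbitrary: ys) (auto simp flip: enc_list_simps)
  have "polytime (\<lambda>x. fold Node (dec_list (enc_list (f x))) Leaf)"
    using assms unfolding polylist_def
    by (intro polytime_fold[where b = "[:1, 1:]"] polytime_Node polytime_const polytime_right
        polytime_left polytime_id) auto
  then show ?thesis using *[of _ "[]"] by (simp add: polylist_def)
qed

text \<open>The fold conses onto its accumulator and thereby reverses the order, which a final
  \<open>rev\<close> repairs. Its growth is additive because the size of \<open>h x e\<close> does
  not depend on the accumulator.\<close>

lemma polylist_map_filter: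
  assumes "ptest (\<lambda>y. P (left y) (right y))" "polytime (\<lambda>y. h (left y) (right y))" "polylist f"
  shows "polylist (\<lambda>x. map (h x) (filter (P x) (f x)))"
proof -
  have *: "fold (\<lambda>e a. if P x e then Node (h x e) a else a) xs (enc_list ys) =
      enc_list (rev (map (h x) (filter (P x) xs)) @ ys)" for x xs ys
    by (induction xs arbitrary: ys) (auto simp flip: enc_list_simps)
  obtain q where q: "\<And>y. size (h (left y) (right y)) \<le> poly q (size y)"
    using polytime_bound[OF assms(2)] by auto
  have pair: "polytime (\<lambda>y. Node (left y) (left (right y)))"
    by (intro polytime_Node polytime_left polytime_right polytime_id)
  have "polytime (\<lambda>x. fold (\<lambda>e a. if P x e then Node (h x e) a else a)
      (dec_list (enc_list (f x))) Leaf)"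
  proof (intro polytime_fold polytime_if polytime_Node polytime_right polytime_id polytime_const)
    show "ptest (\<lambda>y. P (left y) (left (right y)))"
      using ptest_comp[OF assms(1) pair] by simp
    show "polytime (\<lambda>y. h (left y) (left (right y)))"
      using polytime_comp[OF assms(2) pair] by simp
    show "size (if P c e then Node (h c e) a else a) \<le>
        size a + poly (pcompose q [:1, 1:] + [:1:]) (size c + size e)" for c e a
      using q[of "Node c e"] by (simp add: poly_pcompose)
    show "polytime (\<lambda>x. enc_list (f x))" using assms(3) by (simp add: polylist_def)
  qed
  then have "polylist (\<lambda>x. rev (map (h x) (filter (P x) (f x))))"
    using *[of _ _ "[]"] by (simp add: polylist_def)
  from polylist_rev[OF this] show ?thesis by simp
qed

lemma polylist_map:
  assumes "polytime (\<lambda>y. h (left y) (right y))" "polylist f"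
  shows "polylist (\<lambda>x. map (h x) (f x))"
  using polylist_map_filter[where P = "\<lambda>_ _. True", OF ptest_const assms] by simp

lemma polylist_filter:
  assumes "ptest (\<lambda>y. P (left y) (right y))" "polylist f"
  shows "polylist (\<lambda>x. filter (P x) (f x))"
  using polylist_map_filter[where h = "\<lambda>_ e. e", OF assms(1) _ assms(2)]
  by (simp add: polytime_right polytime_id)

lemma polynat_length:
  assumes "polylist f"
  shows "polynat (\<lambda>x. length (f x))"
  using polylist_map[where h = "\<lambda>_ _. Leaf", OF polytime_const assms]
  by (simp add: polylist_def polynat_def enc_nat_eq_enc_list map_replicate_const)

lemma polynat_len: "polytime f \<Longrightarrow> polynat (\<lambda>x. len (f x))"
  unfolding len_def by (intro polynat_length polylist_dec)

lemma polynat_const: "polynat (\<lambda>x. n)"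
  unfolding polynat_def by (rule polytime_const)

lemma polynat_add:
  assumes "polynat f" "polynat g"
  shows "polynat (\<lambda>x. f x + g x)"
proof -
  have *: "fold (\<lambda>_. Node Leaf) (replicate m Leaf) (enc_nat n) = enc_nat (m + n)" for m n
    by (induction m arbitrary: n) (auto simp flip: enc_nat_simps(2))
  have "polytime (\<lambda>x. fold (\<lambda>_. Node Leaf) (dec_list (enc_nat (f x))) (enc_nat (g x)))"
    using assms unfolding polynat_def
    by (intro polytime_fold[where b = "[:1:]"] polytime_Node polytime_const polytime_right
        polytime_left polytime_id) auto
  then show ?thesis unfolding dec_list_enc_nat * by (simp add: polynat_def)
qed

text \<open>Repeated addition: each round adds \<open>g x\<close>, whose size is bounded in terms of
  the context alone, as the growth condition on folds demands.\<close>

lemma polynat_mult: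
  assumes "polynat f" "polynat g"
  shows "polynat (\<lambda>x. f x * g x)"
proof -
  have *: "fold (\<lambda>_ a. enc_nat (len a + n)) (replicate m Leaf) (enc_nat l) = enc_nat (l + m * n)"
    for m n l
    by (induction m arbitrary: l) (auto simp: add.assoc)
  obtain q where q: "\<And>x. g x \<le> poly q (size x)"
    using polytime_bound[OF assms(2)[unfolded polynat_def]] by auto
  have "polytime (\<lambda>x. fold (\<lambda>_ a. enc_nat (len a + g x)) (dec_list (enc_nat (f x))) (enc_nat 0))"
  proof (intro polytime_fold polytime_const)
    show "polytime (\<lambda>x. enc_nat (f x))" using assms(1) by (simp add: polynat_def)
    have "polynat (\<lambda>y. g (left y))"
      using assms(2) unfolding polynat_def
      by (rule polytime_comp) (intro polytime_left polytime_id)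
    then have "polynat (\<lambda>y. len (right (right y)) + g (left y))"
      by (intro polynat_add polynat_len polytime_right polytime_id)
    then show "polytime (\<lambda>y. enc_nat (len (right (right y)) + g (left y)))"
      by (simp add: polynat_def)
    show "size (enc_nat (len a + g c)) \<le> size a + poly q (size c + size e)" for c e a :: tree
      using len_le_size[of a] q[of c] poly_nat_mono[of "size c" "size c + size e" q] by simp
  qed
  then show ?thesis unfolding dec_list_enc_nat * by (simp add: polynat_def)
qed

lemma polynat_poly: "polynat f \<Longrightarrow> polynat (\<lambda>x. poly p (f x))"
  by (induction p) (auto intro!: polynat_add polynat_mult polynat_const)

lemma polytime_drop:
  assumes "polynat g" "polytime f"
  shows "polytime (\<lambda>x. (right ^^ g x) (f x))"
proof -
  have *: "fold (\<lambda>_. right) (replicate m Leaf) t = (right ^^ m) t" for m t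
    by (induction m arbitrary: t) (auto simp del: funpow.simps(2) simp: funpow_Suc_right)
  have "polytime (\<lambda>x. fold (\<lambda>_. right) (dec_list (enc_nat (g x))) (f x))"
    using assms unfolding polynat_def
    by (intro polytime_fold[where b = 0] polytime_right polytime_id) (auto simp: size_right_le)
  then show ?thesis unfolding dec_list_enc_nat * .
qed

lemma drop_enc_nat: "(right ^^ m) (enc_nat n) = enc_nat (n - m)"
proof (induction m arbitrary: n)
  case (Suc m)
  from Suc[of 0] Suc[of "n - 1"] show ?case
    by (cases n) (auto simp del: funpow.simps(2) simp: funpow_Suc_right)
qed simp

text \<open>Removing \<open>g x\<close> layers from the numeral of \<open>f x\<close> is truncated
  subtraction, and the comparison asks whether \<open>Leaf\<close> remains.\<close>

lemma ptest_le:
  assumes "polynat f" "polynat g"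
  shows "ptest (\<lambda>x. f x \<le> g x)"
proof -
  have "ptest (\<lambda>x. \<not> (right ^^ g x) (enc_nat (f x)) \<noteq> Leaf)"
    using assms by (intro ptest_not ptest_nonleaf polytime_drop) (auto simp: polynat_def)
  moreover have "(\<not> (right ^^ n) (enc_nat m) \<noteq> Leaf) = (m \<le> n)" for m n
    unfolding drop_enc_nat by (cases "m - n") auto
  ultimately show ?thesis by simp
qed

lemma ptest_eq: "polynat f \<Longrightarrow> polynat g \<Longrightarrow> ptest (\<lambda>x. f x = g x)"
  unfolding eq_iff by (intro ptest_conj ptest_le)

text \<open>Halving by counting: the accumulator pairs a parity bit with the half counted so far,
  and every second round adds one to the half. The start value \<open>Leaf\<close> behaves like the
  pair of even parity and zero, since both selectors map it to \<open>Leaf\<close>.\<close>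

lemma polynat_half:
  assumes "polynat f"
  shows "polynat (\<lambda>x. f x div 2)"
proof -
  let ?h = "\<lambda>a. if left a \<noteq> Leaf then Node Leaf (Node Leaf (right a))
    else Node (Node Leaf Leaf) (right a)"
  have *: "fold (\<lambda>_. ?h) (replicate m Leaf) Leaf =
      (if m = 0 then Leaf else Node (enc_bool (odd m)) (enc_nat (m div 2)))" for m
  proof (induction m)
    case (Suc m)
    have "replicate (Suc m) Leaf = replicate m Leaf @ [Leaf]" by (simp add: replicate_append_same)
    then show ?case using Suc.IH by (auto simp: enc_bool_def elim: oddE)
  qed simp
  have "polytime (\<lambda>x. fold (\<lambda>_. ?h) (dec_list (enc_nat (f x))) Leaf)"
  proof (intro polytime_fold[where b = "[:2:]"] polytime_cond polytime_Node polytime_left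
      polytime_right polytime_id polytime_const)
    show "polytime (\<lambda>x. enc_nat (f x))" using assms by (simp add: polynat_def)
    show "size (?h a) \<le> size a + poly [:2:] (size c + size e)" for c e a :: tree
      by (cases a) auto
  qed
  then have "polytime (\<lambda>x. right (fold (\<lambda>_. ?h) (dec_list (enc_nat (f x))) Leaf))"
    by (rule polytime_right)
  moreover have "right (fold (\<lambda>_. ?h) (dec_list (enc_nat m)) Leaf) = enc_nat (m div 2)" for m
    unfolding dec_list_enc_nat * by auto
  ultimately show ?thesis by (simp only: polynat_def)
qed

lemma polynats_iff_polylist: "polynats f \<longleftrightarrow> polylist (\<lambda>x. map enc_nat (f x))"
  by (simp add: polynats_def polylist_def)

lemma polynats_comp: "polynats f \<Longrightarrow> polytime g \<Longrightarrow> polynats (\<lambda>x. f (g x))"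
  unfolding polynats_def by (rule polytime_comp)

lemma polynats_length: "polynats f \<Longrightarrow> polynat (\<lambda>x. length (f x))"
  using polynat_length[of "\<lambda>x. map enc_nat (f x)"] by (simp add: polynats_iff_polylist)

lemma polynats_lens: "polytime f \<Longrightarrow> polynats (\<lambda>x. lens (f x))"
  unfolding polynats_iff_polylist lens_def map_map comp_def
  by (intro polylist_map polylist_dec)
     (simp_all add: polynat_len[unfolded polynat_def] polytime_right polytime_id)

text \<open>The length of the list built so far is the next number to prepend, whence the descending
  order. The guard \<open>len a \<le> n\<close> always succeeds on these accumulators; it makes the
  growth of a round bounded by the context for arbitrary trees \<open>a\<close>.\<close>

lemma polynats_upt:
  assumes "polynat f"
  shows "polynats (\<lambda>x. rev [0..<f x])"
proof -
  let ?h = "\<lambda>n a. if len a \<le> n then Node (enc_nat (len a)) a else a"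
  have *: "m \<le> Suc n \<Longrightarrow> fold (\<lambda>_. ?h n) (replicate m Leaf) Leaf =
      enc_list (map enc_nat (rev [0..<m]))" for m n
  proof (induction m)
    case (Suc m)
    have "replicate (Suc m) Leaf = replicate m Leaf @ [Leaf]" by (simp add: replicate_append_same)
    then show ?case using Suc by (auto simp: len_def)
  qed simp
  obtain q where q: "\<And>x. f x \<le> poly q (size x)"
    using polytime_bound[OF assms[unfolded polynat_def]] by auto
  have "polytime (\<lambda>x. fold (\<lambda>_. ?h (f x)) (dec_list (enc_nat (f x))) Leaf)"
  proof (intro polytime_fold polytime_if ptest_le polytime_Node polynat_len polytime_right
      polytime_id polytime_const)
    show "polytime (\<lambda>x. enc_nat (f x))" using assms by (simp add: polynat_def)
    show "polynat (\<lambda>y. f (left y))"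
      using assms unfolding polynat_def by (rule polytime_comp) (intro polytime_left polytime_id)
    show "polytime (\<lambda>y. enc_nat (len (right (right y))))"
      unfolding polynat_def[symmetric] by (intro polynat_len polytime_right polytime_id)
    show "size (?h (f c) a) \<le> size a + poly (q + [:1:]) (size c + size e)" for c e a :: tree
      using q[of c] poly_nat_mono[of "size c" "size c + size e" q] by simp
  qed
  then show ?thesis unfolding dec_list_enc_nat *[OF le_SucI[OF le_refl]] polynats_def .
qed

lemma ptest_bex_nats:
  assumes "ptest (\<lambda>y. P (left y) (len (right y)))" "polynats f"
  shows "ptest (\<lambda>x. \<exists>i\<in>set (f x). P x i)"
  using ptest_bex[where P = "\<lambda>x t. P x (len t)", OF assms(1) assms(2)[unfolded polynats_iff_polylist]]
  by (simp add: polynats_iff_polylist)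

lemma ptest_ex_less:
  assumes "ptest (\<lambda>y. P (left y) (len (right y)))" "polynat f"
  shows "ptest (\<lambda>x. \<exists>i<f x. P x i)"
  using ptest_bex_nats[OF assms(1) polynats_upt[OF assms(2)]] by (simp add: Bex_def)

lemma polynats_filter:
  assumes "ptest (\<lambda>y. P (left y) (len (right y)))" "polynats f"
  shows "polynats (\<lambda>x. filter (P x) (f x))"
  using polylist_filter[where P = "\<lambda>x t. P x (len t)", OF assms(1) assms(2)[unfolded polynats_iff_polylist]]
  by (simp add: polynats_iff_polylist filter_map comp_def)

lemma polylist_map_nats:
  assumes "polytime (\<lambda>y. h (left y) (len (right y)))" "polynats f"
  shows "polylist (\<lambda>x. map (h x) (f x))"
  using polylist_map[where h = "\<lambda>x t. h x (len t)", OF assms(1) assms(2)[unfolded polynats_iff_polylist]]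
  by (simp add: polynats_iff_polylist comp_def)

text \<open>As \<open>m\<close> is constant, \<open>m\<close> nested loops over the numbers below
  \<open>n x\<close> still take polynomial time.\<close>

lemma ptest_ex_tuple:
  assumes "ptest (\<lambda>y. P (left y) (right y))" "polynat n"
  shows "ptest (\<lambda>x. \<exists>vs. length vs = m \<and> set vs \<subseteq> {..<n x} \<and> P x (enc_list (map enc_nat vs)))"
proof -
  \<comment> \<open>\<open>u\<close> is the stack of values chosen by the enclosing loops.
    Generalizing over it carries the induction on \<open>m\<close>; the outermost loop chooses the
    last entry of \<open>vs\<close>.\<close>
  let ?env = "\<lambda>vs u. foldr Node (map enc_nat vs) u"
  have *: "ptest (\<lambda>y. \<exists>vs. length vs = m \<and> set vs \<subseteq> {..<n (left y)} \<and> P (left y) (?env vs (right y)))"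
  proof (induction m)
    case 0
    then show ?case using assms(1) by simp
  next
    case (Suc m)
    let ?R = "\<lambda>x u. \<exists>vs. length vs = m \<and> set vs \<subseteq> {..<n x} \<and> P x (?env vs u)"
    have "ptest (\<lambda>y. \<exists>i<n (left y). ?R (left y) (Node (enc_nat i) (right y)))"
    proof (rule ptest_ex_less)
      have "polytime (\<lambda>y. Node (left (left y)) (Node (enc_nat (len (right y))) (right (left y))))"
        unfolding polynat_def[symmetric]
        by (intro polytime_Node polytime_left polytime_right polytime_id
            polynat_len[unfolded polynat_def])
      from ptest_comp[OF Suc.IH this]
      show "ptest (\<lambda>y. ?R (left (left y)) (Node (enc_nat (len (right y))) (right (left y))))"
        by simp
      show "polynat (\<lambda>x. n (left x))"
        using assms(2) unfolding polynat_def by (rule polytime_comp) (intro polytime_left polytime_id)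
    qed
    moreover have "(\<exists>i<n x. ?R x (Node (enc_nat i) u)) \<longleftrightarrow>
        (\<exists>vs. length vs = Suc m \<and> set vs \<subseteq> {..<n x} \<and> P x (?env vs u))" for x u
    proof
      assume "\<exists>i<n x. ?R x (Node (enc_nat i) u)"
      then obtain i vs where "i < n x" "length vs = m" "set vs \<subseteq> {..<n x}"
        "P x (?env vs (Node (enc_nat i) u))" by blast
      then show "\<exists>vs. length vs = Suc m \<and> set vs \<subseteq> {..<n x} \<and> P x (?env vs u)"
        by (intro exI[of _ "vs @ [i]"]) auto
    next
      assume "\<exists>vs. length vs = Suc m \<and> set vs \<subseteq> {..<n x} \<and> P x (?env vs u)"
      then obtain vs where vs: "length vs = Suc m" "set vs \<subseteq> {..<n x}" "P x (?env vs u)" by blast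
      then obtain ws i where "vs = ws @ [i]" by (cases vs rule: rev_cases) auto
      with vs show "\<exists>i<n x. ?R x (Node (enc_nat i) u)" by auto
    qed
    ultimately show ?case by simp
  qed
  have "polytime (\<lambda>x. Node x Leaf)" by (intro polytime_Node polytime_id polytime_const)
  from ptest_comp[OF * this] show ?thesis by (simp add: enc_list_def)
qed

section \<open>Iteration a logarithmic number of times\<close>

fun bit_length :: "nat \<Rightarrow> nat" where
  "bit_length m = (if m = 0 then 0 else Suc (bit_length (m div 2)))"

declare bit_length.simps [simp del]

lemma bit_length_0 [simp]: "bit_length 0 = 0"
  by (simp add: bit_length.simps)

lemma bit_length_pos: "m > 0 \<Longrightarrow> bit_length m = Suc (bit_length (m div 2))"
  by (simp add: bit_length.simps)

text \<open>The loop runs for \<open>k x\<close> rounds with a counter that starts at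
  \<open>k x\<close> and is halved in each; once it is 0 the remaining rounds change nothing, so the
  logarithm is never computed. The bound on \<open>E x W\<close> must not depend on
  \<open>W\<close>: growth that is merely polynomial in each round could explode under
  iteration.\<close>

lemma polynats_funpow_bit_length:
  assumes "polynats (\<lambda>y. E (left y) (lens (right y)))"
    and "\<And>x W. size (enc_list (map enc_nat (E x W))) \<le> poly b (size x)"
    and "polynat k" "polynats f"
  shows "polynats (\<lambda>x. (E x ^^ bit_length (k x)) (f x))"
proof -
  let ?nats = "\<lambda>W. enc_list (map enc_nat W)"
  let ?h = "\<lambda>x a. Node (enc_nat (len (left a) div 2))
     (if len (left a) = 0 then right a else ?nats (E x (lens (right a))))"
  \<comment> \<open>\<open>m \<le> n\<close> says that enough rounds remain for the counter to reach
    0.\<close>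
  have *: "m \<le> n \<Longrightarrow> fold (\<lambda>_. ?h x) (replicate n Leaf) (Node (enc_nat m) (?nats W)) =
      Node Leaf (?nats ((E x ^^ bit_length m) W))" for m n x W
  proof (induction n arbitrary: m W)
    case 0
    then show ?case by simp
  next
    case (Suc n)
    show ?case
    proof (cases "m = 0")
      case True
      then show ?thesis using Suc.IH[of 0] by simp
    next
      case False
      then have "m div 2 \<le> n" using Suc.prems by linarith
      then show ?thesis using Suc.IH[of "m div 2"] False by (simp add: bit_length_pos funpow_Suc_right del: funpow.simps(2))
    qed
  qed
  have "polytime (\<lambda>x. fold (\<lambda>_. ?h x) (dec_list (enc_nat (k x))) (Node (enc_nat (k x)) (?nats (f x))))"
  proof (intro polytime_fold polytime_if ptest_eq polytime_Node polynat_len polytime_right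
      polytime_left polytime_id polynat_const)
    show "polytime (\<lambda>x. enc_nat (k x))" using assms(3) by (simp add: polynat_def)
    then show "polytime (\<lambda>x. enc_nat (k x))" .
    show "polytime (\<lambda>x. ?nats (f x))" using assms(4) by (simp add: polynats_def)
    show "polytime (\<lambda>y. enc_nat (len (left (right (right y))) div 2))"
      unfolding polynat_def[symmetric]
      by (intro polynat_half polynat_len polytime_left polytime_right polytime_id)
    have "polytime (\<lambda>y. Node (left y) (right (right (right y))))"
      by (intro polytime_Node polytime_left polytime_right polytime_id)
    from polytime_comp[OF assms(1)[unfolded polynats_def] this]
    show "polytime (\<lambda>y. ?nats (E (left y) (lens (right (right (right y))))))" by simp
    show "size (?h c a) \<le> size a + poly (b + [:1:]) (size c + size e)" for c e a :: tree
    proof -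
      have "poly b (size c) \<le> poly b (size c + size e)" by (intro poly_nat_mono) simp
      moreover have "len (left a) div 2 + size (right a) \<le> size a"
        using len_le_size[of "left a"] by (cases a) auto
      ultimately show ?thesis using assms(2)[of c "lens (right a)"] by auto
    qed
  qed
  from polytime_right[OF this] show ?thesis
    unfolding dec_list_enc_nat *[OF le_refl] polynats_def by simp
qed

section \<open>Isomorphisms and induced copies\<close>

lemma graph_isoE:
  assumes "graph_iso G H"
  obtains f where "bij_betw f (verts G) (verts H)" "(\<lambda>e. f ` e) ` edges G = edges H"
  using assms unfolding graph_iso_def by blast

lemma graph_iso_trans:
  assumes "graph_iso G H" "graph_iso H K"
  shows "graph_iso G K"
proof -
  obtain f where f: "bij_betw f (verts G) (verts H)" "(\<lambda>e. f ` e) ` edges G = edges H"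
    using assms(1) by (rule graph_isoE)
  obtain g where g: "bij_betw g (verts H) (verts K)" "(\<lambda>e. g ` e) ` edges H = edges K"
    using assms(2) by (rule graph_isoE)
  have "bij_betw (g \<circ> f) (verts G) (verts K)" using f(1) g(1) by (rule bij_betw_trans)
  moreover have "(\<lambda>e. (g \<circ> f) ` e) ` edges G = edges K"
    unfolding g(2)[symmetric] f(2)[symmetric] by (simp add: image_image)
  ultimately show ?thesis unfolding graph_iso_def by blast
qed

lemma graph_iso_sym:
  assumes "graph_iso G H" "\<And>e. e \<in> edges G \<Longrightarrow> e \<subseteq> verts G"
  shows "graph_iso H G"
proof -
  obtain f where f: "bij_betw f (verts G) (verts H)" "(\<lambda>e. f ` e) ` edges G = edges H"
    using assms(1) by (rule graph_isoE)
  let ?g = "inv_into (verts G) f"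
  have "?g ` f ` e = e" if "e \<in> edges G" for e
    using assms(2)[OF that] f(1) by (simp add: bij_betw_def inv_into_image_cancel)
  then have "(\<lambda>e. ?g ` e) ` edges H = edges G"
    unfolding f(2)[symmetric] image_image by simp
  with bij_betw_inv_into[OF f(1)] show ?thesis unfolding graph_iso_def by blast
qed

lemma induced_subgraph_simps [simp]:
  "verts (induced_subgraph G S) = S"
  "edges (induced_subgraph G S) = {e \<in> edges G. e \<subseteq> S}"
  by (auto simp: induced_subgraph_def)

lemma delete_edges_simps [simp]:
  "verts (delete_edges G F) = verts G"
  "edges (delete_edges G F) = edges G - F"
  by (auto simp: delete_edges_def)

definition induced_copy :: "'a sgraph set \<Rightarrow> 'b sgraph \<Rightarrow> 'b set \<Rightarrow> bool" where
  "induced_copy \<H> G S \<longleftrightarrow> S \<subseteq> verts G \<and> (\<exists>H\<in>\<H>. graph_iso H (induced_subgraph G S))"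

lemma free_of_iff: "free_of \<H> G \<longleftrightarrow> (\<forall>S. \<not> induced_copy \<H> G S)"
  by (auto simp: free_of_def induced_copy_def)

text \<open>A copy sees only the edges inside \<open>S\<close>. This transfers copies between a
  graph, its induced subgraphs and its edge deletions; where it fails to apply, \<open>S\<close>
  must contain an edge that was changed.\<close>

lemma induced_copy_cong:
  assumes "S \<subseteq> verts G \<longleftrightarrow> S \<subseteq> verts G'" "\<And>e. e \<subseteq> S \<Longrightarrow> e \<in> edges G \<longleftrightarrow> e \<in> edges G'"
  shows "induced_copy \<H> G S \<longleftrightarrow> induced_copy \<H> G' S"
proof -
  have "induced_subgraph G S = induced_subgraph G' S"
    using assms(2) by (auto simp: induced_subgraph_def)
  with assms(1) show ?thesis by (simp add: induced_copy_def)
qed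

lemma card_induced_copy_ge:
  assumes "\<And>H. H \<in> \<H> \<Longrightarrow> card (verts H) \<ge> m" "induced_copy \<H> G S"
  shows "card S \<ge> m"
proof -
  obtain H where H: "H \<in> \<H>" "graph_iso H (induced_subgraph G S)"
    using assms(2) by (auto simp: induced_copy_def)
  then obtain f where "bij_betw f (verts H) S" by (auto elim: graph_isoE)
  then show ?thesis using assms(1)[OF H(1)] bij_betw_same_card by metis
qed

lemma induced_copy_induced_subgraph:
  assumes "W \<subseteq> verts G"
  shows "induced_copy \<H> (induced_subgraph G W) S \<longleftrightarrow> induced_copy \<H> G S \<and> S \<subseteq> W"
proof (cases "S \<subseteq> W")
  case True
  with assms show ?thesis by (subst induced_copy_cong[where G' = G]) auto
qed (simp add: induced_copy_def)

lemma free_of_induced_subgraph: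
  "W \<subseteq> verts G \<Longrightarrow> free_of \<H> G \<Longrightarrow> free_of \<H> (induced_subgraph G W)"
  by (simp add: free_of_iff induced_copy_induced_subgraph)

lemma free_of_graph_iso:
  assumes "graph_iso G G'" "\<And>e. e \<in> edges G \<Longrightarrow> e \<subseteq> verts G" "free_of \<H> G"
  shows "free_of \<H> G'"
  unfolding free_of_iff
proof (intro allI notI)
  fix S assume "induced_copy \<H> G' S"
  then obtain H where H: "S \<subseteq> verts G'" "H \<in> \<H>" "graph_iso H (induced_subgraph G' S)"
    by (auto simp: induced_copy_def)
  obtain g where g: "bij_betw g (verts G') (verts G)" "(\<lambda>e. g ` e) ` edges G' = edges G"
    using graph_iso_sym[OF assms(1,2)] by (rule graph_isoE)
  have edge: "e \<subseteq> verts G'" if e: "e \<in> edges G'" for e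
  proof -
    obtain f where f: "bij_betw f (verts G) (verts G')" "(\<lambda>e. f ` e) ` edges G = edges G'"
      using assms(1) by (rule graph_isoE)
    then obtain e0 where e0: "e0 \<in> edges G" "e = f ` e0" using e by blast
    have "f ` e0 \<subseteq> f ` verts G" using assms(2)[OF e0(1)] by (rule image_mono)
    with e0(2) f(1) show ?thesis by (simp add: bij_betw_def)
  qed
  have "bij_betw g S (g ` S)"
    using g(1) H(1) by (meson bij_betw_def inj_on_subset)
  moreover have "(\<lambda>e. g ` e) ` {e \<in> edges G'. e \<subseteq> S} = {e \<in> edges G. e \<subseteq> g ` S}"
  proof (intro equalityI subsetI)
    fix e assume "e \<in> {e \<in> edges G. e \<subseteq> g ` S}"
    then have "e \<in> (\<lambda>e. g ` e) ` edges G'" "e \<subseteq> g ` S" using g(2) by auto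
    then obtain e' where e': "e' \<in> edges G'" "e = g ` e'" "g ` e' \<subseteq> g ` S" by auto
    have "x \<in> S" if "x \<in> e'" for x
      using inj_on_image_mem_iff[of g "verts G'" x S] that e'(3) edge[OF e'(1)] H(1) g(1)
      by (auto simp: bij_betw_def)
    then have "e' \<subseteq> S" by blast
    with e' show "e \<in> (\<lambda>e. g ` e) ` {e \<in> edges G'. e \<subseteq> S}" by simp
  qed (use g(2) in auto)
  ultimately have "graph_iso (induced_subgraph G' S) (induced_subgraph G (g ` S))"
    unfolding graph_iso_def by auto
  then have "graph_iso H (induced_subgraph G (g ` S))" using H(3) graph_iso_trans by blast
  moreover have "g ` S \<subseteq> verts G" using H(1) g(1) by (auto simp: bij_betw_def)
  ultimately show False using assms(3) H(2) by (auto simp: free_of_iff induced_copy_def)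
qed

text \<open>\<open>deletion_yes\<close> for graphs on an arbitrary vertex type.\<close>

definition deletable :: "'a sgraph set \<Rightarrow> 'b sgraph \<Rightarrow> nat \<Rightarrow> bool" where
  "deletable \<H> G k \<longleftrightarrow> (\<exists>F\<subseteq>edges G. card F \<le> k \<and> free_of \<H> (delete_edges G F))"

lemma deletable_graph_iso:
  assumes "graph_iso G G'" "simple_graph G" "deletable \<H> G k"
  shows "deletable \<H> G' k"
proof -
  obtain f where f: "bij_betw f (verts G) (verts G')" "(\<lambda>e. f ` e) ` edges G = edges G'"
    using assms(1) by (rule graph_isoE)
  obtain F where F: "F \<subseteq> edges G" "card F \<le> k" "free_of \<H> (delete_edges G F)"
    using assms(3) by (auto simp: deletable_def)
  have sub: "e \<subseteq> verts G" if "e \<in> edges G" for e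
    using assms(2) that by (auto simp: simple_graph_def)
  have inj: "inj_on (\<lambda>e. f ` e) (edges G)"
    using f(1) sub by (auto simp: inj_on_def bij_betw_def inj_on_image_eq_iff[of f "verts G"])
  have "finite (edges G)"
    by (rule finite_subset[of _ "Pow (verts G)"]) (use assms(2) sub in \<open>auto simp: simple_graph_def\<close>)
  then have "card ((\<lambda>e. f ` e) ` F) \<le> k"
    using F(2) card_image_le[OF finite_subset[OF F(1)], of "\<lambda>e. f ` e"] by simp
  moreover have "(\<lambda>e. f ` e) ` F \<subseteq> edges G'" using F(1) f(2) by blast
  moreover have "graph_iso (delete_edges G F) (delete_edges G' ((\<lambda>e. f ` e) ` F))"
    unfolding graph_iso_def using f inj F(1)
    by (intro exI[of _ f]) (auto simp: inj_on_image_set_diff[OF inj, of "edges G" F])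
  then have "free_of \<H> (delete_edges G' ((\<lambda>e. f ` e) ` F))"
    by (rule free_of_graph_iso) (use F(3) sub in auto)
  ultimately show ?thesis unfolding deletable_def by blast
qed

section \<open>Connectedness and neighbourhoods\<close>

lemma connected_graph_iso:
  assumes "graph_iso H G" "connected_graph H"
  shows "connected_graph G"
proof -
  obtain f where f: "bij_betw f (verts H) (verts G)" "(\<lambda>e. f ` e) ` edges H = edges G"
    using assms(1) by (rule graph_isoE)
  have path: "(f u, f v) \<in> {(x, y). {x, y} \<in> edges G}\<^sup>*" if "(u, v) \<in> {(x, y). {x, y} \<in> edges H}\<^sup>*" for u v
    using that
  proof (induction rule: rtrancl_induct)
    case (step y z)
    then have "{y, z} \<in> edges H" by simp
    then have "f ` {y, z} \<in> edges G" using f(2) by blast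
    then have "(f y, f z) \<in> {(x, y). {x, y} \<in> edges G}" by simp
    with step.IH show ?case by (rule rtrancl_into_rtrancl)
  qed simp
  have "verts G = f ` verts H" using f(1) by (simp add: bij_betw_def)
  with assms(2) path show ?thesis by (auto simp: connected_graph_def)
qed

text \<open>A path from \<open>a\<close> to a vertex outside \<open>A\<close> has a first step that
  leaves \<open>A\<close>.\<close>

lemma connected_graph_crossing_edge:
  assumes "connected_graph G" "a \<in> verts G" "a \<in> A" "\<not> verts G \<subseteq> A"
  obtains x y where "x \<in> A" "y \<notin> A" "{x, y} \<in> edges G"
proof -
  obtain b where b: "b \<in> verts G" "b \<notin> A" using assms(4) by blast
  with assms(1,2) have "(a, b) \<in> {(x, y). {x, y} \<in> edges G}\<^sup>*" by (auto simp: connected_graph_def)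
  then have "\<exists>x y. x \<in> A \<and> y \<notin> A \<and> {x, y} \<in> edges G"
    using b(2) by (induction rule: rtrancl_induct) (use assms(3) in blast)+
  with that show ?thesis by blast
qed

section \<open>Closed neighbourhoods, balls and degrees\<close>

definition nbhd :: "'b sgraph \<Rightarrow> 'b set \<Rightarrow> 'b set" where
  "nbhd G W = {v \<in> verts G. v \<in> W \<or> (\<exists>w\<in>W. {v, w} \<in> edges G)}"

abbreviation ball :: "'b sgraph \<Rightarrow> nat \<Rightarrow> 'b set \<Rightarrow> 'b set" where
  "ball G i \<equiv> nbhd G ^^ i"

lemma ball_subset_verts: "W \<subseteq> verts G \<Longrightarrow> ball G i W \<subseteq> verts G"
  by (cases i) (auto simp: nbhd_def)

lemma ball_add: "ball G j (ball G i W) = ball G (i + j) W"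
  by (simp add: add.commute[of i] funpow_add)

lemma ball_increasing: "W \<subseteq> verts G \<Longrightarrow> i \<le> j \<Longrightarrow> ball G i W \<subseteq> ball G j W"
proof (induction j)
  case (Suc j)
  then have "ball G j W \<subseteq> ball G (Suc j) W"
    using ball_subset_verts[of W G j] by (auto simp: nbhd_def)
  with Suc show ?case by (cases "i = Suc j") auto
qed simp

text \<open>As long as \<open>S\<close> is not covered, an edge inside \<open>S\<close> leaves the
  current ball, so every expansion swallows a further vertex of \<open>S\<close>. Connectedness is
  taken in the sparser graph \<open>G'\<close> and distance in \<open>G\<close>, because copies will
  be considered after edge deletions but balls always in the original graph.\<close>

lemma connected_subset_ball:
  assumes "finite S" "card S \<le> d" "S \<subseteq> verts G" "connected_graph (induced_subgraph G' S)"
    "edges G' \<subseteq> edges G" "N \<subseteq> verts G" "S \<inter> N \<noteq> {}"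
  shows "S \<subseteq> ball G d N"
proof -
  have "S \<subseteq> ball G i N \<or> i < card (ball G i N \<inter> S)" for i
  proof (induction i)
    case 0
    show ?case using assms(1,7) by (auto simp: card_gt_0_iff)
  next
    case (Suc i)
    have inc: "ball G i N \<subseteq> ball G (Suc i) N" using assms(6) by (intro ball_increasing) auto
    show ?case
    proof (cases "S \<subseteq> ball G i N")
      case False
      with Suc.IH have "i < card (ball G i N \<inter> S)" by simp
      then obtain a where a: "a \<in> ball G i N" "a \<in> S" by (cases "ball G i N \<inter> S = {}") auto
      obtain x y where "x \<in> ball G i N" "y \<notin> ball G i N" "{x, y} \<in> edges (induced_subgraph G' S)"
        by (rule connected_graph_crossing_edge[OF assms(4), of a "ball G i N"]) (use a False in auto)
      then have xy: "x \<in> ball G i N" "y \<notin> ball G i N" "{x, y} \<in> edges G'" "{x, y} \<subseteq> S" by auto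
      then have "y \<in> ball G (Suc i) N" using assms(3,5) by (auto simp: nbhd_def insert_commute)
      with xy inc have "ball G i N \<inter> S \<subset> ball G (Suc i) N \<inter> S" by blast
      then have "card (ball G i N \<inter> S) < card (ball G (Suc i) N \<inter> S)"
        using assms(1) by (intro psubset_card_mono) auto
      with \<open>i < card (ball G i N \<inter> S)\<close> show ?thesis by linarith
    qed (use inc in blast)
  qed
  from this[of d] show ?thesis
    using assms(1,2) card_mono[OF assms(1), of "ball G d N \<inter> S"] by auto
qed

definition nbrs :: "'b sgraph \<Rightarrow> 'b \<Rightarrow> 'b set" where
  "nbrs G v = {w. {v, w} \<in> edges G}"

lemma not_in_nbrs: "simple_graph G \<Longrightarrow> v \<notin> nbrs G v"
proof
  assume "simple_graph G" "v \<in> nbrs G v"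
  then have "card {v} = 2" by (simp add: nbrs_def simple_graph_def)
  then show False by simp
qed

lemma nbrs_subset: "simple_graph G \<Longrightarrow> nbrs G v \<subseteq> verts G"
  by (auto simp: nbrs_def simple_graph_def)

lemma finite_nbrs: "simple_graph G \<Longrightarrow> finite (nbrs G v)"
  using nbrs_subset[of G v] finite_subset by (auto simp: simple_graph_def)

lemma finite_edges: "simple_graph G \<Longrightarrow> finite (edges G)"
  by (rule finite_subset[of _ "Pow (verts G)"]) (auto simp: simple_graph_def)

lemma edge_cases:
  assumes "simple_graph G" "e \<in> edges G"
  obtains a b where "e = {a, b}" "a \<noteq> b" "a \<in> verts G" "b \<in> verts G"
proof -
  have "e \<subseteq> verts G" "card e = 2" using assms by (auto simp: simple_graph_def)
  with that show ?thesis by (metis card_2_iff insert_subset)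
qed

lemma card_incident_edges_le:
  assumes "simple_graph G" "finite Y" "\<And>y. y \<in> Y \<Longrightarrow> card (nbrs G y) \<le> D"
  shows "card {e \<in> edges G. e \<inter> Y \<noteq> {}} \<le> D * card Y"
proof -
  have "{e \<in> edges G. e \<inter> Y \<noteq> {}} \<subseteq> (\<Union>y\<in>Y. (\<lambda>w. {y, w}) ` nbrs G y)"
  proof
    fix e assume "e \<in> {e \<in> edges G. e \<inter> Y \<noteq> {}}"
    then have e: "e \<in> edges G" "e \<inter> Y \<noteq> {}" by auto
    obtain a b where "e = {a, b}" using edge_cases[OF assms(1) e(1)] by metis
    with e(2) obtain y w where "y \<in> Y" "e = {y, w}" by blast
    with e(1) show "e \<in> (\<Union>y\<in>Y. (\<lambda>w. {y, w}) ` nbrs G y)" by (auto simp: nbrs_def)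
  qed
  moreover have "finite (\<Union>y\<in>Y. (\<lambda>w. {y, w}) ` nbrs G y)"
    by (simp add: assms(1,2) finite_nbrs)
  ultimately have "card {e \<in> edges G. e \<inter> Y \<noteq> {}} \<le> card (\<Union>y\<in>Y. (\<lambda>w. {y, w}) ` nbrs G y)"
    by (rule card_mono[rotated])
  also have "\<dots> \<le> (\<Sum>y\<in>Y. card ((\<lambda>w. {y, w}) ` nbrs G y))" by (rule card_UN_le[OF assms(2)])
  also have "\<dots> \<le> (\<Sum>y\<in>Y. D)"
    by (intro sum_mono le_trans[OF card_image_le[OF finite_nbrs[OF assms(1)]] assms(3)])
  finally show ?thesis by (simp add: mult.commute)
qed

lemma card_Union_edges_le:
  assumes "simple_graph G" "F \<subseteq> edges G"
  shows "card (\<Union>F) \<le> 2 * card F"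
proof -
  have "card (\<Union>F) \<le> sum card F" by (rule card_Union_le_sum_card)
  also have "\<dots> = (\<Sum>e\<in>F. 2)"
    using assms by (intro sum.cong) (auto simp: simple_graph_def)
  finally show ?thesis by simp
qed

text \<open>Vertices in \<open>Z\<close> may have any degree: their neighbours already belong to
  \<open>W\<close> and contribute nothing new. \<open>Z\<close> will be the set of copy vertices,
  where no constant degree bound is available.\<close>

lemma card_nbhd_le:
  assumes "simple_graph G" "W \<subseteq> verts G" "\<And>v. v \<in> W - Z \<Longrightarrow> card (nbrs G v) \<le> D"
    and "nbhd G Z \<subseteq> W"
  shows "card (nbhd G W) \<le> (1 + D) * card W"
proof -
  have fin: "finite W" using assms(1,2) finite_subset by (auto simp: simple_graph_def)
  have "nbhd G W \<subseteq> W \<union> (\<Union>w\<in>W-Z. nbrs G w)"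
  proof
    fix x assume "x \<in> nbhd G W"
    then consider "x \<in> W" | w where "w \<in> W" "{w, x} \<in> edges G" "x \<in> verts G"
      by (auto simp: nbhd_def insert_commute)
    then show "x \<in> W \<union> (\<Union>w\<in>W-Z. nbrs G w)"
    proof cases
      case 2
      then show ?thesis
        using assms(4) by (cases "w \<in> Z") (auto simp: nbrs_def nbhd_def insert_commute)
    qed simp
  qed
  then have "card (nbhd G W) \<le> card (W \<union> (\<Union>w\<in>W-Z. nbrs G w))"
    using fin finite_nbrs[OF assms(1)] by (intro card_mono) auto
  also have "\<dots> \<le> card W + (\<Sum>w\<in>W-Z. card (nbrs G w))"
    using card_Un_le[of W "\<Union>w\<in>W-Z. nbrs G w"] card_UN_le[of "W - Z" "nbrs G"] fin by simp
  also have "(\<Sum>w\<in>W-Z. card (nbrs G w)) \<le> (\<Sum>w\<in>W-Z. D)" using assms(3) by (intro sum_mono) auto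
  also have "\<dots> \<le> D * card W" using fin by (simp add: card_mono mult.commute)
  finally show ?thesis by simp
qed

lemma card_ball_le:
  assumes "simple_graph G" "W \<subseteq> verts G" "\<And>v. v \<in> verts G - Z \<Longrightarrow> card (nbrs G v) \<le> D"
    and "nbhd G Z \<subseteq> W"
  shows "card (ball G i W) \<le> (1 + D) ^ i * card W"
proof (induction i)
  case (Suc i)
  have "W \<subseteq> ball G i W" using ball_increasing[OF assms(2), of 0 i] by simp
  then have "card (nbhd G (ball G i W)) \<le> (1 + D) * card (ball G i W)"
    using assms ball_subset_verts[OF assms(2)] by (intro card_nbhd_le[where Z = Z]) blast+
  also have "\<dots> \<le> (1 + D) * ((1 + D) ^ i * card W)" by (intro mult_left_mono Suc.IH) simp
  finally show ?case by (simp add: algebra_simps)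
qed simp

section \<open>Locality of minimum deletion sets\<close>

definition copy_verts :: "'a sgraph set \<Rightarrow> 'b sgraph \<Rightarrow> 'b set" where
  "copy_verts \<H> G = \<Union>{S. induced_copy \<H> G S}"

lemma copy_verts_subset: "copy_verts \<H> G \<subseteq> verts G"
  by (auto simp: copy_verts_def induced_copy_def)

definition far_edges :: "'a sgraph set \<Rightarrow> 'b sgraph \<Rightarrow> 'b set set \<Rightarrow> nat \<Rightarrow> 'b set set" where
  "far_edges \<H> G F i = {e \<in> F. \<not> e \<subseteq> ball G i (copy_verts \<H> G)}"

lemma far_edges_antimono: "i \<le> j \<Longrightarrow> far_edges \<H> G F j \<subseteq> far_edges \<H> G F i"
  using ball_increasing[OF copy_verts_subset[of \<H> G], of i j] unfolding far_edges_def by blast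

locale connected_family =
  fixes \<H> :: "'a sgraph set" and d :: nat
  assumes simple: "H \<in> \<H> \<Longrightarrow> simple_graph H"
    and connected: "H \<in> \<H> \<Longrightarrow> connected_graph H"
    and card_verts: "H \<in> \<H> \<Longrightarrow> card (verts H) \<le> d"
begin

lemma induced_copyD:
  assumes "induced_copy \<H> G S"
  shows "S \<subseteq> verts G" "finite S" "card S \<le> d" "connected_graph (induced_subgraph G S)"
proof -
  obtain H where H: "H \<in> \<H>" "graph_iso H (induced_subgraph G S)"
    using assms by (auto simp: induced_copy_def)
  then obtain f where f: "bij_betw f (verts H) S" by (auto elim: graph_isoE)
  show "S \<subseteq> verts G" using assms by (simp add: induced_copy_def)
  show "finite S" using bij_betw_finite[OF f] simple[OF H(1)] by (simp add: simple_graph_def)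
  show "card S \<le> d" using bij_betw_same_card[OF f] card_verts[OF H(1)] by simp
  show "connected_graph (induced_subgraph G S)" using connected_graph_iso[OF H(2) connected[OF H(1)]] .
qed

lemma induced_copy_subset_ball:
  assumes "induced_copy \<H> G' S" "verts G' = verts G" "edges G' \<subseteq> edges G" "N \<subseteq> verts G" "S \<inter> N \<noteq> {}"
  shows "S \<subseteq> ball G d N"
  using induced_copyD[OF assms(1)] assms(2-5) by (intro connected_subset_ball) auto

text \<open>Trading the deleted edges outside the ball of radius \<open>i + d\<close> for the isolation of the
  endpoints of the deleted edges in the shell between the radii \<open>i\<close> and \<open>i + d\<close> again gives a
  deletion set: an induced copy in the new graph avoids the isolated vertices and is too small to
  cross the shell.\<close>

lemma isolate_shell_free:
  assumes "simple_graph G" "F \<subseteq> edges G" "free_of \<H> (delete_edges G F)"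
    and large: "\<And>H. H \<in> \<H> \<Longrightarrow> card (verts H) \<ge> 2"
    and A: "A = F - far_edges \<H> G F (i + d)"
    and Y: "Y = \<Union>(far_edges \<H> G F i - far_edges \<H> G F (i + d))"
  shows "free_of \<H> (delete_edges G (A \<union> {e \<in> edges G. e \<inter> Y \<noteq> {}}))"
  unfolding free_of_iff
proof (intro allI notI)
  let ?X = "copy_verts \<H> G" and ?G' = "delete_edges G (A \<union> {e \<in> edges G. e \<inter> Y \<noteq> {}})"
  fix S assume copy: "induced_copy \<H> ?G' S"
  have "card S \<ge> 2" using large copy by (rule card_induced_copy_ge)
  \<comment> \<open>Vertices of \<open>Y\<close> are isolated in \<open>?G'\<close>, whereas a
    connected graph on at least two vertices has no isolated vertex.\<close>
  have SY: "S \<inter> Y = {}"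
  proof (rule ccontr)
    assume "S \<inter> Y \<noteq> {}"
    then obtain y where y: "y \<in> S" "y \<in> Y" by blast
    have "\<not> S \<subseteq> {y}" using \<open>card S \<ge> 2\<close> card_mono[of "{y}" S] by auto
    then obtain x z where "x \<in> {y}" "{x, z} \<in> edges (induced_subgraph ?G' S)"
      using connected_graph_crossing_edge[OF induced_copyD(4)[OF copy], of y "{y}"] y by auto
    with y show False by auto
  qed
  \<comment> \<open>\<open>S\<close> was no copy after deleting \<open>F\<close>, so it contains a
    restored edge \<open>f\<close>, which leaves the ball of radius \<open>i + d\<close>.\<close>
  have "\<not> induced_copy \<H> (delete_edges G F) S" using assms(3) by (simp add: free_of_iff)
  then have "\<exists>e\<subseteq>S. \<not> (e \<in> edges ?G' \<longleftrightarrow> e \<in> edges (delete_edges G F))"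
    using copy induced_copy_cong[of S ?G' "delete_edges G F" \<H>] by auto
  then obtain f where f: "f \<subseteq> S" "f \<in> edges G" "f \<in> F" "f \<notin> A"
    using SY A by auto
  have far: "\<not> f \<subseteq> ball G (i + d) ?X" using f A by (auto simp: far_edges_def)
  \<comment> \<open>Because of \<open>f\<close>, \<open>S\<close> is not inside \<open>?X\<close>
    and so no copy in \<open>G\<close> either; hence it also contains an edge \<open>g\<close> that
    is still deleted.\<close>
  have "\<not> S \<subseteq> ?X"
    using far f(1) ball_increasing[OF copy_verts_subset[of \<H> G], of 0 "i + d"] by auto
  then have "\<not> induced_copy \<H> G S" by (auto simp: copy_verts_def)
  then have "\<exists>e\<subseteq>S. \<not> (e \<in> edges ?G' \<longleftrightarrow> e \<in> edges G)"
    using copy induced_copy_cong[of S ?G' G \<H>] by auto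
  then obtain g where g: "g \<subseteq> S" "g \<in> A" "g \<in> edges G"
    using SY assms(1) by auto
  have "card g = 2" using assms(1) g(3) by (simp add: simple_graph_def)
  then have "g \<noteq> {}" by auto
  have "g \<in> F" "g \<notin> far_edges \<H> G F (i + d)" using g(2) A by auto
  \<comment> \<open>A shell edge would have its endpoints in \<open>Y\<close>, which
    \<open>S\<close> avoids. So \<open>g\<close> lies in the inner ball, and from there
    \<open>S\<close> cannot reach out to \<open>f\<close>.\<close>
  have "g \<notin> far_edges \<H> G F i"
  proof
    assume "g \<in> far_edges \<H> G F i"
    with \<open>g \<notin> far_edges \<H> G F (i + d)\<close> have "g \<subseteq> Y" using Y by auto
    with g(1) SY \<open>g \<noteq> {}\<close> show False by blast
  qed
  with \<open>g \<in> F\<close> have "g \<subseteq> ball G i ?X" by (auto simp: far_edges_def)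
  with g(1) \<open>g \<noteq> {}\<close> have "S \<inter> ball G i ?X \<noteq> {}" by blast
  then have "S \<subseteq> ball G d (ball G i ?X)"
    using induced_copy_subset_ball[OF copy, of G "ball G i ?X"]
      ball_subset_verts[OF copy_verts_subset[of \<H> G]] by auto
  with far f(1) show False by (auto simp: ball_add)
qed

text \<open>If the one-vertex graph belongs to the family, every vertex is a copy, so that there are no
  far edges at all.\<close>

lemma far_edges_drop:
  assumes G: "simple_graph G" and F: "F \<subseteq> edges G" "free_of \<H> (delete_edges G F)"
    and min: "\<And>F'. F' \<subseteq> edges G \<Longrightarrow> free_of \<H> (delete_edges G F') \<Longrightarrow> card F \<le> card F'"
    and deg: "\<And>v. v \<in> verts G - copy_verts \<H> G \<Longrightarrow> card (nbrs G v) \<le> D"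
    and "i > 0"
  shows "card (far_edges \<H> G F (i + d)) \<le>
    2 * D * (card (far_edges \<H> G F i) - card (far_edges \<H> G F (i + d)))"
proof (cases "\<forall>H\<in>\<H>. card (verts H) \<ge> 2")
  case True
  let ?T = "far_edges \<H> G F" and ?X = "copy_verts \<H> G"
  define A where "A = F - ?T (i + d)"
  define Y where "Y = \<Union>(?T i - ?T (i + d))"
  let ?E = "{e \<in> edges G. e \<inter> Y \<noteq> {}}"
  have finF: "finite F" using finite_subset[OF F(1) finite_edges[OF G]] .
  have TF: "?T j \<subseteq> F" for j by (auto simp: far_edges_def)
  have finT: "finite (?T j)" for j using finite_subset[OF TF finF] .
  have "free_of \<H> (delete_edges G (A \<union> ?E))"
    using isolate_shell_free[OF G F _ A_def Y_def] True by blast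
  \<comment> \<open>The trade cannot beat a minimum solution, so the edges given back,
    \<open>?T (i + d)\<close>, are at most as many as the edges \<open>?E\<close> spent on isolating
    \<open>Y\<close>.\<close>
  then have "card F \<le> card (A \<union> ?E)" using F(1) by (intro min) (auto simp: A_def)
  also have "\<dots> \<le> card A + card ?E" by (rule card_Un_le)
  also have "card A = card F - card (?T (i + d))"
    unfolding A_def using finT TF by (intro card_Diff_subset)
  finally have "card (?T (i + d)) \<le> card ?E"
    using card_mono[OF finF TF, of "i + d"] by linarith
  also have "\<dots> \<le> D * card Y"
  proof (intro card_incident_edges_le[OF G])
    show "finite Y"
    proof (rule finite_subset)
      have "e \<subseteq> verts G" if "e \<in> F" for e using that F(1) G by (auto simp: simple_graph_def)
      then show "Y \<subseteq> verts G" using TF unfolding Y_def by blast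
    qed (use G in \<open>simp add: simple_graph_def\<close>)
    fix y assume "y \<in> Y"
    then obtain e where e: "e \<in> ?T i" "y \<in> e" by (auto simp: Y_def)
    then have "e \<in> edges G" "\<not> e \<subseteq> ball G i ?X" using F(1) by (auto simp: far_edges_def)
    then obtain a b where "e = {a, b}" "a \<in> verts G" "b \<in> verts G"
      using edge_cases[OF G] by metis
    with e(2) obtain z where z: "e = {y, z}" "z \<in> verts G" "y \<in> verts G" by blast
    \<comment> \<open>This is where \<open>i > 0\<close> matters: an edge with an endpoint in
      \<open>?X\<close> lies in the ball of radius 1 and is not far. Hence the constant degree bound
      applies to all of \<open>Y\<close>.\<close>
    have "y \<notin> ?X"
    proof
      assume "y \<in> ?X"
      then have "y \<in> ball G 1 ?X" "z \<in> ball G 1 ?X"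
        using z \<open>e \<in> edges G\<close> by (auto simp: nbhd_def insert_commute)
      then have "e \<subseteq> ball G i ?X"
        using ball_increasing[OF copy_verts_subset[of \<H> G], of 1 i] \<open>i > 0\<close> z(1) by auto
      with \<open>\<not> e \<subseteq> ball G i ?X\<close> show False ..
    qed
    with deg z(3) show "card (nbrs G y) \<le> D" by blast
  qed
  also have "\<dots> \<le> D * (2 * card (?T i - ?T (i + d)))"
    unfolding Y_def using F(1) TF by (intro mult_left_mono card_Union_edges_le[OF G]) blast+
  also have "card (?T i - ?T (i + d)) = card (?T i) - card (?T (i + d))"
    by (rule card_Diff_subset[OF finT far_edges_antimono]) simp
  finally show ?thesis by (simp only: mult_ac)
next
  case False
  then obtain H where H: "H \<in> \<H>" "card (verts H) \<le> 1" by force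
  moreover have "card (verts H) > 0"
    using connected[OF H(1)] simple[OF H(1)]
    by (auto simp: connected_graph_def simple_graph_def card_gt_0_iff)
  ultimately have "card (verts H) = 1" by linarith
  then obtain h where h: "verts H = {h}" by (auto simp: card_1_singleton_iff)
  have "edges H = {}"
  proof (rule ccontr)
    assume "edges H \<noteq> {}"
    then obtain e where "e \<subseteq> {h}" "card e = 2" using simple[OF H(1)] h by (auto simp: simple_graph_def)
    then show False using card_mono[of "{h}" e] by simp
  qed
  have "induced_copy \<H> G {v}" if "v \<in> verts G" for v
  proof -
    have "{e \<in> edges G. e \<subseteq> {v}} = {}"
    proof (rule ccontr)
      assume "{e \<in> edges G. e \<subseteq> {v}} \<noteq> {}"
      then obtain e where "e \<subseteq> {v}" "card e = 2" using G by (auto simp: simple_graph_def)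
      then show False using card_mono[of "{v}" e] by simp
    qed
    then have "graph_iso H (induced_subgraph G {v})"
      unfolding graph_iso_def using h \<open>edges H = {}\<close>
      by (intro exI[of _ "\<lambda>_. v"]) (auto simp: bij_betw_def)
    with that H(1) show ?thesis by (auto simp: induced_copy_def)
  qed
  then have "copy_verts \<H> G = verts G"
    using copy_verts_subset[of \<H> G] by (auto simp: copy_verts_def)
  then have "e \<subseteq> ball G (i + d) (copy_verts \<H> G)" if "e \<in> F" for e
  proof -
    have "e \<subseteq> verts G" using that F(1) G by (auto simp: simple_graph_def)
    then show ?thesis
      unfolding \<open>copy_verts \<H> G = verts G\<close> using ball_increasing[of "verts G" G 0 "i + d"] by simp
  qed
  then have "far_edges \<H> G F (i + d) = {}" by (auto simp: far_edges_def)
  then show ?thesis by simp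
qed

text \<open>Let \<open>t\<close> edges remain beyond the outer radius. By
  \<open>far_edges_drop\<close> each of the \<open>2 * D\<close> shells of width \<open>d\<close> in
  between contains at least \<open>t / (2 * D)\<close> deleted edges, so together they contain at
  least \<open>t\<close>.\<close>

lemma far_edges_halve:
  assumes G: "simple_graph G" and F: "F \<subseteq> edges G" "free_of \<H> (delete_edges G F)"
    and min: "\<And>F'. F' \<subseteq> edges G \<Longrightarrow> free_of \<H> (delete_edges G F') \<Longrightarrow> card F \<le> card F'"
    and deg: "\<And>v. v \<in> verts G - copy_verts \<H> G \<Longrightarrow> card (nbrs G v) \<le> D"
    and "i > 0" "D > 0"
  shows "2 * card (far_edges \<H> G F (i + 2 * D * d)) \<le> card (far_edges \<H> G F i)"
proof -
  let ?T = "\<lambda>i. card (far_edges \<H> G F i)"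
  have finF: "finite F" using finite_subset[OF F(1) finite_edges[OF G]] .
  have anti: "?T j' \<le> ?T j" if "j \<le> j'" for j j'
    by (rule card_mono[OF _ far_edges_antimono[OF that]]) (simp add: far_edges_def finF)
  let ?t = "?T (i + 2 * D * d)"
  \<comment> \<open>The shell count after \<open>j\<close> shells, multiplied by
    \<open>2 * D\<close> to avoid division.\<close>
  have "2 * D * ?T (i + j * d) + j * ?t \<le> 2 * D * ?T i" if "j \<le> 2 * D" for j
    using that
  proof (induction j)
    case (Suc j)
    have "?t \<le> ?T (i + j * d + d)"
    proof (rule anti)
      show "i + j * d + d \<le> i + 2 * D * d"
        using mult_le_mono1[OF Suc.prems, of d] by simp
    qed
    also have "\<dots> \<le> 2 * D * (?T (i + j * d) - ?T (i + j * d + d))"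
      using far_edges_drop[OF G F min deg, of "i + j * d"] \<open>i > 0\<close> by simp
    also have "\<dots> = 2 * D * ?T (i + j * d) - 2 * D * ?T (i + j * d + d)" by (rule diff_mult_distrib2)
    finally have "?t + 2 * D * ?T (i + j * d + d) \<le> 2 * D * ?T (i + j * d)"
      using anti[of "i + j * d" "i + j * d + d"] mult_le_mono2[of "?T (i + j * d + d)" "?T (i + j * d)" "2 * D"]
      by linarith
    then show ?case using Suc by (simp add: algebra_simps)
  qed simp
  from this[of "2 * D"] have "2 * D * (2 * ?t) \<le> 2 * D * ?T i" by (simp add: algebra_simps)
  with \<open>D > 0\<close> show ?thesis by simp
qed

text \<open>Halving needs a positive radius and therefore starts at 1, with at most \<open>k\<close>
  far edges; \<open>bit_length k\<close> halvings, each of width \<open>2 * D * d\<close>, leave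
  none.\<close>

lemma minimum_deletion_in_ball:
  assumes G: "simple_graph G" and F: "F \<subseteq> edges G" "free_of \<H> (delete_edges G F)"
    and min: "\<And>F'. F' \<subseteq> edges G \<Longrightarrow> free_of \<H> (delete_edges G F') \<Longrightarrow> card F \<le> card F'"
    and deg: "\<And>v. v \<in> verts G - copy_verts \<H> G \<Longrightarrow> card (nbrs G v) \<le> D"
    and "D > 0" "card F \<le> k" "e \<in> F"
  shows "e \<subseteq> ball G (1 + 2 * D * d * bit_length k) (copy_verts \<H> G)"
proof -
  have finF: "finite F" using finite_subset[OF F(1) finite_edges[OF G]] .
  have *: "card (far_edges \<H> G F (i + 2 * D * d * bit_length m)) = 0"
    if "i > 0" "card (far_edges \<H> G F i) \<le> m" for i m
    using that
  proof (induction m arbitrary: i rule: less_induct)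
    case (less m)
    show ?case
    proof (cases "m = 0")
      case False
      have "card (far_edges \<H> G F (i + 2 * D * d)) \<le> m div 2"
        using far_edges_halve[OF G F min deg less.prems(1) \<open>D > 0\<close>] less.prems(2) by simp
      with less.IH[of "m div 2" "i + 2 * D * d"] less.prems(1) False show ?thesis
        by (simp add: bit_length_pos add.assoc)
    qed (use less.prems in simp)
  qed
  have "far_edges \<H> G F 1 \<subseteq> F" by (auto simp: far_edges_def)
  then have "card (far_edges \<H> G F 1) \<le> k"
    using card_mono[OF finF] \<open>card F \<le> k\<close> le_trans by blast
  then have "card (far_edges \<H> G F (1 + 2 * D * d * bit_length k)) = 0" by (intro *) auto
  moreover have "finite (far_edges \<H> G F j)" for j using finF by (simp add: far_edges_def)
  ultimately have "far_edges \<H> G F (1 + 2 * D * d * bit_length k) = {}" by simp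
  with \<open>e \<in> F\<close> show ?thesis unfolding far_edges_def by blast
qed

section \<open>The kernel\<close>

lemma deletable_induced_subgraph:
  assumes "simple_graph G" "deletable \<H> G k" "W \<subseteq> verts G"
  shows "deletable \<H> (induced_subgraph G W) k"
proof -
  obtain F where F: "F \<subseteq> edges G" "card F \<le> k" "free_of \<H> (delete_edges G F)"
    using assms(2) by (auto simp: deletable_def)
  let ?F = "{e \<in> F. e \<subseteq> W}"
  have "card ?F \<le> card F"
    using finite_subset[OF F(1) finite_edges[OF assms(1)]] by (intro card_mono) auto
  moreover have "delete_edges (induced_subgraph G W) ?F = induced_subgraph (delete_edges G F) W"
    by (auto simp: delete_edges_def induced_subgraph_def)
  then have "free_of \<H> (delete_edges (induced_subgraph G W) ?F)"
    using free_of_induced_subgraph[OF _ F(3)] assms(3) by simp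
  ultimately show ?thesis using F(1,2) unfolding deletable_def by (intro exI[of _ ?F]) auto
qed

lemma nbrs_induced_subgraph: "nbrs (induced_subgraph G W) v \<subseteq> nbrs G v"
  by (auto simp: nbrs_def)

lemma nbhd_induced_subgraph:
  assumes "A \<subseteq> W" "nbhd G A \<subseteq> W" "W \<subseteq> verts G"
  shows "nbhd (induced_subgraph G W) A = nbhd G A"
proof (intro equalityI subsetI)
  fix v assume v: "v \<in> nbhd G A"
  then have "v \<in> W" using assms(2) by blast
  moreover have "{v, w} \<subseteq> W" if "w \<in> A" for w using that assms(1) \<open>v \<in> W\<close> by blast
  ultimately show "v \<in> nbhd (induced_subgraph G W) A" using v unfolding nbhd_def by auto
qed (use assms(3) in \<open>auto simp: nbhd_def\<close>)

text \<open>A ball contains the shortest paths back to its centre, so removing vertices outside it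
  changes nothing. It is needed because locality is proved in the induced subgraph while
  \<open>W\<close> is a ball of \<open>G\<close>.\<close>

lemma ball_induced_subgraph:
  assumes "X \<subseteq> verts G" "ball G i X \<subseteq> W" "W \<subseteq> verts G"
  shows "ball (induced_subgraph G W) i X = ball G i X"
  using assms(2)
proof (induction i)
  case (Suc i)
  then have "ball G i X \<subseteq> W" using ball_increasing[OF assms(1), of i "Suc i" ] by fastforce
  then have "ball (induced_subgraph G W) i X = ball G i X" by (rule Suc.IH)
  then show ?case
    using nbhd_induced_subgraph[OF \<open>ball G i X \<subseteq> W\<close> _ assms(3)] Suc.prems by simp
qed simp

text \<open>The direction from the subgraph to \<open>G\<close> is the substantial one. A minimum
  solution of the subgraph stays at distance at least \<open>d\<close> from where \<open>W\<close>
  was cut off, so that deleting it from \<open>G\<close> cannot produce a copy that leaves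
  \<open>W\<close>.\<close>

theorem deletable_kernel:
  assumes G: "simple_graph G" and W: "W = ball G (1 + 2 * D * d * bit_length k + d) (copy_verts \<H> G)"
    and deg: "\<And>v. v \<in> verts G - copy_verts \<H> G \<Longrightarrow> card (nbrs G v) \<le> D" and "D > 0"
  shows "deletable \<H> (induced_subgraph G W) k \<longleftrightarrow> deletable \<H> G k"
proof
  let ?X = "copy_verts \<H> G" and ?G' = "induced_subgraph G W" and ?r = "1 + 2 * D * d * bit_length k"
  have WG: "W \<subseteq> verts G" unfolding W by (rule ball_subset_verts[OF copy_verts_subset])
  show "deletable \<H> ?G' k" if "deletable \<H> G k"
    using deletable_induced_subgraph[OF G that WG] .
  assume "deletable \<H> ?G' k"
  let ?sol = "\<lambda>F. F \<subseteq> edges ?G' \<and> free_of \<H> (delete_edges ?G' F)"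
  obtain F0 where F0: "?sol F0" "card F0 \<le> k" using \<open>deletable \<H> ?G' k\<close> by (auto simp: deletable_def)
  \<comment> \<open>The given solution \<open>F0\<close> may contain edges far from
    \<open>?X\<close>; only a minimum one is known to be local.\<close>
  define F where "F = arg_min card ?sol"
  have F: "F \<subseteq> edges ?G'" "free_of \<H> (delete_edges ?G' F)"
    using arg_min_natI[of ?sol F0 card] F0(1) unfolding F_def by blast+
  have min: "card F \<le> card F'" if "F' \<subseteq> edges ?G'" "free_of \<H> (delete_edges ?G' F')" for F'
    unfolding F_def using that by (intro arg_min_nat_le) blast
  have G': "simple_graph ?G'"
    using G WG finite_subset[OF WG] by (auto simp: simple_graph_def)
  have XW: "ball G i ?X \<subseteq> W" if "i \<le> ?r + d" for i
    unfolding W by (rule ball_increasing[OF copy_verts_subset that])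
  \<comment> \<open>All copies of \<open>G\<close> lie inside \<open>W\<close>, so the subgraph has
    the same ones and its balls have the same centre.\<close>
  have X': "copy_verts \<H> ?G' = ?X"
  proof -
    have "S \<subseteq> W" if "induced_copy \<H> G S" for S
      using that XW[of 0] by (auto simp: copy_verts_def)
    then show ?thesis unfolding copy_verts_def induced_copy_induced_subgraph[OF WG] by blast
  qed
  have deg': "card (nbrs ?G' v) \<le> D" if "v \<in> verts ?G' - copy_verts \<H> ?G'" for v
    using that deg[of v] WG card_mono[OF finite_nbrs[OF G] nbrs_induced_subgraph, of W v] X' by fastforce
  have loc: "e \<subseteq> ball G ?r ?X" if "e \<in> F" for e
    using minimum_deletion_in_ball[OF G' F min deg' \<open>D > 0\<close> _ that, of k]
      min[of F0] F0 ball_induced_subgraph[OF copy_verts_subset XW WG, of ?r] X' by simp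
  have "free_of \<H> (delete_edges G F)"
    unfolding free_of_iff
  proof (intro allI notI)
    fix S assume copy: "induced_copy \<H> (delete_edges G F) S"
    \<comment> \<open>If \<open>S\<close> contains a deleted edge, it meets the ball of radius
      \<open>?r\<close>, and the last \<open>d\<close> steps of the radius cover it. Otherwise it is
      already a copy in \<open>G\<close> and lies in \<open>?X\<close>.\<close>
    have "S \<subseteq> W"
    proof (cases "\<exists>e\<in>F. e \<subseteq> S")
      case True
      then obtain e where e: "e \<in> F" "e \<subseteq> S" by blast
      then have "card e = 2" using F(1) G' by (auto simp: simple_graph_def)
      then have "e \<noteq> {}" by auto
      then have "S \<inter> ball G ?r ?X \<noteq> {}" using loc[OF e(1)] e(2) by blast
      then have "S \<subseteq> ball G d (ball G ?r ?X)"
        by (intro induced_copy_subset_ball[OF copy _ _ ball_subset_verts[OF copy_verts_subset]])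
           simp_all
      then show ?thesis unfolding W ball_add .
    next
      case False
      then have "induced_copy \<H> G S"
        using copy induced_copy_cong[of S "delete_edges G F" G \<H>] by auto
      then show ?thesis using XW[of 0] by (auto simp: copy_verts_def)
    qed
    then have "induced_copy \<H> (delete_edges ?G' F) S"
      using copy induced_copy_cong[of S "delete_edges G F" "delete_edges ?G' F" \<H>] WG by auto
    with F(2) show False by (simp add: free_of_iff)
  qed
  moreover have "card F \<le> k" using min[of F0] F0 by simp
  ultimately show "deletable \<H> G k" using F(1) unfolding deletable_def by auto
qed

text \<open>A solution destroys every copy of \<open>G\<close>, so each copy contains a deleted edge
  and, being connected, stays close to its endpoints.\<close>

lemma copy_verts_subset_ball:
  assumes G: "simple_graph G" and F: "F \<subseteq> edges G" "free_of \<H> (delete_edges G F)"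
  shows "copy_verts \<H> G \<subseteq> ball G d (\<Union>F)"
proof
  fix v assume "v \<in> copy_verts \<H> G"
  then obtain S where S: "induced_copy \<H> G S" "v \<in> S" by (auto simp: copy_verts_def)
  have "\<not> induced_copy \<H> (delete_edges G F) S" using F(2) by (simp add: free_of_iff)
  then obtain e where e: "e \<in> F" "e \<subseteq> S"
    using S(1) induced_copy_cong[of S G "delete_edges G F" \<H>] by auto
  then have "card e = 2" using F(1) G by (auto simp: simple_graph_def)
  then have "e \<noteq> {}" by auto
  with e have "S \<inter> \<Union>F \<noteq> {}" by blast
  moreover have "\<Union>F \<subseteq> verts G" using F(1) G by (auto simp: simple_graph_def)
  ultimately show "v \<in> ball G d (\<Union>F)" using induced_copy_subset_ball[OF S(1)] S(2) by blast
qed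

text \<open>This makes the size of a ball of logarithmic radius polynomial in
  \<open>k\<close>.\<close>

lemma power_bit_length_le: "k > 0 \<Longrightarrow> 2 ^ bit_length k \<le> 2 * k"
proof (induction k rule: less_induct)
  case (less k)
  show ?case
  proof (cases "k div 2 = 0")
    case True
    with less.prems show ?thesis by (simp add: bit_length_pos)
  next
    case False
    then have "2 ^ bit_length (k div 2) \<le> 2 * (k div 2)" using less.prems by (intro less.IH) auto
    with less.prems show ?thesis by (simp add: bit_length_pos)
  qed
qed

text \<open>The general degree bound \<open>M\<close> is charged \<open>d + 1\<close> times:
  \<open>d\<close> times for a ball around the endpoints of deleted edges that covers the copy
  vertices, and once for the step out of them. From then on the neighbours of all copy vertices are
  inside, and each step costs only the factor \<open>1 + D\<close>.\<close>

lemma card_kernel_le: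
  assumes G: "simple_graph G" and "deletable \<H> G k"
    and deg: "\<And>v. v \<in> verts G - copy_verts \<H> G \<Longrightarrow> card (nbrs G v) \<le> D"
    and maxdeg: "\<And>v. v \<in> verts G \<Longrightarrow> card (nbrs G v) \<le> M"
  shows "card (ball G (1 + c * bit_length k + d) (copy_verts \<H> G)) \<le>
    (1 + D) ^ d * (2 * k + 1) ^ (D * c) * ((1 + M) * ((1 + M) ^ d * (2 * k)))"
proof -
  let ?X = "copy_verts \<H> G"
  obtain F where F: "F \<subseteq> edges G" "card F \<le> k" "free_of \<H> (delete_edges G F)"
    using assms(2) by (auto simp: deletable_def)
  have UF: "\<Union>F \<subseteq> verts G" using F(1) G by (auto simp: simple_graph_def)
  have finV: "finite (verts G)" using G by (simp add: simple_graph_def)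
  have fin: "finite (ball G i W)" if "W \<subseteq> verts G" for i W
    using finite_subset[OF ball_subset_verts[OF that] finV] .
  have "card ?X \<le> card (ball G d (\<Union>F))"
    using copy_verts_subset_ball[OF G F(1,3)] fin[OF UF] by (intro card_mono)
  also have "\<dots> \<le> (1 + M) ^ d * card (\<Union>F)"
    by (rule card_ball_le[OF G UF, of "{}"]) (auto simp: maxdeg nbhd_def)
  also have "\<dots> \<le> (1 + M) ^ d * (2 * k)"
    using card_Union_edges_le[OF G F(1)] F(2) by (intro mult_left_mono) auto
  finally have X: "card ?X \<le> (1 + M) ^ d * (2 * k)" .
  have "card (nbhd G ?X) \<le> (1 + M) * card ?X"
    by (rule card_nbhd_le[where Z = "{}", OF G copy_verts_subset])
       (use copy_verts_subset[of \<H> G] maxdeg in \<open>auto simp: nbhd_def\<close>)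
  also have "\<dots> \<le> (1 + M) * ((1 + M) ^ d * (2 * k))" using X by (intro mult_left_mono) auto
  finally have N: "card (nbhd G ?X) \<le> (1 + M) * ((1 + M) ^ d * (2 * k))" .
  have "ball G (1 + c * bit_length k + d) ?X = ball G (c * bit_length k + d) (nbhd G ?X)"
    using ball_add[where G = G and j = "c * bit_length k + d" and i = 1 and W = ?X]
    by (simp add: add.assoc)
  then have "card (ball G (1 + c * bit_length k + d) ?X) \<le>
      (1 + D) ^ (c * bit_length k + d) * card (nbhd G ?X)"
    using card_ball_le[OF G _ deg, of "nbhd G ?X" ?X] by (simp add: nbhd_def)
  also have "(1 + D) ^ (c * bit_length k + d) = (1 + D) ^ d * ((1 + D) ^ c) ^ bit_length k"
    by (simp add: power_add power_mult)
  \<comment> \<open>\<open>1 + D \<le> 2 ^ D\<close> brings the base to a power of two.\<close>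
  also have "((1 + D) ^ c) ^ bit_length k \<le> ((2 ^ D) ^ c) ^ bit_length k"
    by (intro power_mono) (auto simp: Suc_leI)
  also have "\<dots> = (2 ^ bit_length k) ^ (D * c)"
    by (simp flip: power_mult add: mult.commute mult.left_commute)
  \<comment> \<open>The summand 1 covers \<open>k = 0\<close>, where \<open>2 ^ bit_length k\<close>
    is 1.\<close>
  also have "\<dots> \<le> (2 * k + 1) ^ (D * c)"
    using power_bit_length_le[of k] by (intro power_mono) (cases "k = 0"; simp)+
  finally show ?thesis by (rule le_trans) ((intro mult_le_mono N le_refl | assumption)+)
qed

end

section \<open>Ramsey's theorem and degrees in star-free graphs\<close>

lemma graph_iso_complete:
  assumes "finite S" "card S = t" "\<And>x y. x \<in> S \<Longrightarrow> y \<in> S \<Longrightarrow> x \<noteq> y \<Longrightarrow> {x, y} \<in> edges G"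
    "\<And>e. e \<in> edges G \<Longrightarrow> card e = 2"
  shows "graph_iso (complete_graph t) (induced_subgraph G S)"
proof -
  obtain f where f: "bij_betw f {..<t} S"
    using finite_same_card_bij[of "{..<t}" S] assms(1,2) by auto
  have "(\<lambda>e. f ` e) ` {e. e \<subseteq> {..<t} \<and> card e = 2} = {e \<in> edges G. e \<subseteq> S}"
  proof (intro equalityI subsetI)
    fix e assume "e \<in> (\<lambda>e. f ` e) ` {e. e \<subseteq> {..<t} \<and> card e = 2}"
    then obtain x y where "e = {f x, f y}" "x \<noteq> y" "x < t" "y < t"
      by (auto simp: card_2_iff)
    moreover from this have "f x \<noteq> f y" using f by (auto simp: bij_betw_def inj_on_def)
    moreover have "f x \<in> S" "f y \<in> S" using f \<open>x < t\<close> \<open>y < t\<close> by (auto simp: bij_betw_def)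
    ultimately show "e \<in> {e \<in> edges G. e \<subseteq> S}" using assms(3) by auto
  next
    fix e assume "e \<in> {e \<in> edges G. e \<subseteq> S}"
    then have e: "e \<subseteq> f ` {..<t}" "card e = 2" using assms(4) f by (auto simp: bij_betw_def)
    obtain e' where e': "e' \<subseteq> {..<t}" "e = f ` e'" using subset_imageE[OF e(1)] by metis
    have "inj_on f e'" using inj_on_subset[OF _ e'(1)] f by (auto simp: bij_betw_def)
    with e(2) e' have "card e' = 2" by (simp add: card_image)
    with e' show "e \<in> (\<lambda>e. f ` e) ` {e. e \<subseteq> {..<t} \<and> card e = 2}" by blast
  qed
  with f show ?thesis unfolding graph_iso_def complete_graph_def by auto
qed

lemma graph_iso_star:
  assumes "simple_graph G" "I \<subseteq> nbrs G v" "card I = s" "finite I"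
    "\<And>x y. x \<in> I \<Longrightarrow> y \<in> I \<Longrightarrow> {x, y} \<notin> edges G"
  shows "graph_iso (star_graph s) (induced_subgraph G (insert v I))"
proof -
  obtain g where g: "bij_betw g {1..s} I"
    using finite_same_card_bij[of "{1..s}" I] assms(3,4) by auto
  let ?f = "g(0 := v)"
  have vI: "v \<notin> I" using assms(2) not_in_nbrs[OF assms(1)] by blast
  have f: "bij_betw ?f {0..s} (insert v I)"
  proof -
    have "bij_betw ?f {1..s} I" using g by (subst bij_betw_cong[where g = g]) auto
    moreover have "bij_betw ?f {0} {v}" by (simp add: bij_betw_def)
    ultimately have "bij_betw ?f ({0} \<union> {1..s}) ({v} \<union> I)" using vI by (intro bij_betw_combine) auto
    moreover have "{0} \<union> {1..s} = {0..s}" by auto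
    ultimately show ?thesis by simp
  qed
  have "{{0, i} |i. i \<in> {1..s}} = (\<lambda>i. {0, i}) ` {1..s}" by blast
  then have "(\<lambda>e. ?f ` e) ` {{0, i} |i. i \<in> {1..s}} = (\<lambda>w. {v, w}) ` (g ` {1..s})"
    by (auto simp: image_image intro!: image_cong)
  also have "\<dots> = (\<lambda>w. {v, w}) ` I" using g by (simp add: bij_betw_def)
  also have "\<dots> = {e \<in> edges G. e \<subseteq> insert v I}"
  proof (intro equalityI subsetI)
    fix e assume "e \<in> {e \<in> edges G. e \<subseteq> insert v I}"
    then have e: "e \<in> edges G" "e \<subseteq> insert v I" by auto
    obtain a b where ab: "e = {a, b}" "a \<noteq> b" using edge_cases[OF assms(1) e(1)] by metis
    with e assms(5)[of a b] consider "a = v" "b \<in> I" | "b = v" "a \<in> I" by auto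
    then show "e \<in> (\<lambda>w. {v, w}) ` I" by cases (use ab in auto)
  qed (use assms(2) in \<open>auto simp: nbrs_def\<close>)
  finally have edges: "(\<lambda>e. ?f ` e) ` {{0, i} |i. i \<in> {1..s}} = {e \<in> edges G. e \<subseteq> insert v I}" .
  show ?thesis
    unfolding graph_iso_def star_graph_def
    by (intro exI[of _ ?f] conjI) (simp_all only: sgraph.simps induced_subgraph_simps f edges)
qed

text \<open>An independent set of \<open>s\<close> neighbours would span an induced star with centre
  \<open>v\<close>, so Ramsey's theorem leaves only the clique. \<open>A\<close> may be a part of
  the neighbourhood because neighbours at deleted edges will be left out.\<close>

lemma star_free_large_nbrs_clique:
  obtains r where "\<And>(G :: 'b sgraph) v A. simple_graph G \<Longrightarrow> free_of {star_graph s} G \<Longrightarrow> v \<in> verts G \<Longrightarrow>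
    A \<subseteq> nbrs G v \<Longrightarrow> card A \<ge> r \<Longrightarrow>
    \<exists>C\<subseteq>A. card C = m \<and> (\<forall>x\<in>C. \<forall>y\<in>C. x \<noteq> y \<longrightarrow> {x, y} \<in> edges G)"
proof -
  obtain r where r: "\<And>V (E :: 'b set set). finite V \<Longrightarrow> card V \<ge> r \<Longrightarrow>
      \<exists>R\<subseteq>V. card R = m \<and> clique R E \<or> card R = s \<and> indep R E"
    using ramsey2[of m s] by blast
  have "\<exists>C\<subseteq>A. card C = m \<and> (\<forall>x\<in>C. \<forall>y\<in>C. x \<noteq> y \<longrightarrow> {x, y} \<in> edges G)"
    if G: "simple_graph G" "free_of {star_graph s} G" "v \<in> verts G" and A: "A \<subseteq> nbrs G v" "card A \<ge> r"
    for G :: "'b sgraph" and v A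
  proof -
    have fin: "finite A" using finite_subset[OF A(1) finite_nbrs[OF G(1)]] .
    obtain R where R: "R \<subseteq> A" "card R = m \<and> clique R (edges G) \<or> card R = s \<and> indep R (edges G)"
      using r[OF fin A(2), of "edges G"] by blast
    have "\<not> (card R = s \<and> indep R (edges G))"
    proof
      assume *: "card R = s \<and> indep R (edges G)"
      have "{x, y} \<notin> edges G" if "x \<in> R" "y \<in> R" for x y
        using * that G(1) by (cases "x = y") (auto simp: indep_def simple_graph_def)
      then have "graph_iso (star_graph s) (induced_subgraph G (insert v R))"
        using * R(1) A(1) finite_subset[OF R(1) fin] by (intro graph_iso_star[OF G(1)]) auto
      moreover have "insert v R \<subseteq> verts G" using G(3) R(1) A(1) nbrs_subset[OF G(1), of v] by blast
      ultimately show False using G(2) by (auto simp: free_of_def)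
    qed
    with R show ?thesis by (intro exI[of _ R]) (auto simp: clique_def)
  qed
  with that show ?thesis by blast
qed

lemma clique_induced_copy:
  assumes "\<exists>K\<in>\<H>. graph_iso (complete_graph t) K"
    and "finite S" "card S = t" "S \<subseteq> verts G" "\<And>e. e \<in> edges G \<Longrightarrow> card e = 2"
    and "\<And>x y. x \<in> S \<Longrightarrow> y \<in> S \<Longrightarrow> x \<noteq> y \<Longrightarrow> {x, y} \<in> edges G"
  shows "induced_copy \<H> G S"
proof -
  obtain K where K: "K \<in> \<H>" "graph_iso (complete_graph t) K" using assms(1) by blast
  have "graph_iso K (complete_graph t)"
    using K(2) by (rule graph_iso_sym) (auto simp: complete_graph_def)
  then have "graph_iso K (induced_subgraph G S)"
    using graph_iso_complete[of S t G] assms(2-) by (blast intro: graph_iso_trans)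
  with K(1) assms(4) show ?thesis by (auto simp: induced_copy_def)
qed

text \<open>A clique of \<open>t - 1\<close> neighbours forms a \<open>K_t\<close> with
  \<open>v\<close>. Both bounds come from the same count \<open>few\<close>: once with nothing
  deleted, and once with a solution \<open>F\<close> and the neighbours that are not among its at
  most \<open>2 * k\<close> endpoints.\<close>

lemma degree_bounds:
  fixes \<H> :: "'a sgraph set"
  assumes K: "\<exists>K\<in>\<H>. graph_iso (complete_graph t) K" and "t > 0"
  obtains D where "D > 0"
    "\<And>(G :: 'b sgraph) v. simple_graph G \<Longrightarrow> free_of {star_graph s} G \<Longrightarrow> v \<in> verts G - copy_verts \<H> G \<Longrightarrow>
      card (nbrs G v) \<le> D"
    "\<And>(G :: 'b sgraph) k v. simple_graph G \<Longrightarrow> free_of {star_graph s} G \<Longrightarrow> deletable \<H> G k \<Longrightarrow> v \<in> verts G \<Longrightarrow>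
      card (nbrs G v) \<le> D + 2 * k"
proof -
  obtain r where r: "\<And>(G :: 'b sgraph) v A. simple_graph G \<Longrightarrow> free_of {star_graph s} G \<Longrightarrow> v \<in> verts G \<Longrightarrow>
    A \<subseteq> nbrs G v \<Longrightarrow> card A \<ge> r \<Longrightarrow>
    \<exists>C\<subseteq>A. card C = t - 1 \<and> (\<forall>x\<in>C. \<forall>y\<in>C. x \<noteq> y \<longrightarrow> {x, y} \<in> edges G)"
    using star_free_large_nbrs_clique[of s "t - 1"] by blast
  have few: "card A < r" if G: "simple_graph G" "free_of {star_graph s} G" "v \<in> verts G" "A \<subseteq> nbrs G v"
    and F: "F \<subseteq> edges G" "A \<inter> \<Union>F = {}" and S: "\<And>S. v \<in> S \<Longrightarrow> \<not> induced_copy \<H> (delete_edges G F) S"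
    for G :: "'b sgraph" and v A F
  proof (rule ccontr)
    assume "\<not> card A < r"
    then obtain C where C: "C \<subseteq> A" "card C = t - 1" "\<forall>x\<in>C. \<forall>y\<in>C. x \<noteq> y \<longrightarrow> {x, y} \<in> edges G"
      using r[OF G] by auto
    have fin: "finite C" using finite_subset[OF _ finite_nbrs[OF G(1)]] C(1) G(4) by blast
    have vA: "v \<notin> A" using G(4) not_in_nbrs[OF G(1)] by blast
    have "induced_copy \<H> (delete_edges G F) (insert v C)"
    proof (rule clique_induced_copy[OF K])
      show "card (insert v C) = t" using fin vA C(1,2) \<open>t > 0\<close> by (subst card_insert_disjoint) auto
      show "insert v C \<subseteq> verts (delete_edges G F)"
        using G(3,4) C(1) nbrs_subset[OF G(1), of v] by auto
      fix x y assume "x \<in> insert v C" "y \<in> insert v C" "x \<noteq> y"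
      \<comment> \<open>Every pair in the clique meets \<open>A\<close>, which avoids the endpoints
        of \<open>F\<close>; so no edge of the clique is deleted.\<close>
      then have "{x, y} \<in> edges G" "x \<in> A \<or> y \<in> A"
        using C G(4) by (auto simp: nbrs_def insert_commute)
      then show "{x, y} \<in> edges (delete_edges G F)" using F(2) by auto
    qed (use fin G(1) in \<open>auto simp: simple_graph_def\<close>)
    then show False using S by blast
  qed
  show ?thesis
  \<comment> \<open>The successor makes \<open>D\<close> positive, whatever Ramsey number was
    obtained.\<close>
  proof (rule that[of "Suc r"])
    fix G :: "'b sgraph" and v
    assume G: "simple_graph G" "free_of {star_graph s} G" and v: "v \<in> verts G - copy_verts \<H> G"
    have "\<not> induced_copy \<H> (delete_edges G {}) S" if "v \<in> S" for S
      using that v induced_copy_cong[of S "delete_edges G {}" G \<H>] by (auto simp: copy_verts_def)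
    with few[of G v "nbrs G v" "{}"] G v show "card (nbrs G v) \<le> Suc r" by auto
  next
    fix G :: "'b sgraph" and v k
    assume G: "simple_graph G" "free_of {star_graph s} G" and del: "deletable \<H> G k" and v: "v \<in> verts G"
    obtain F where F: "F \<subseteq> edges G" "card F \<le> k" "free_of \<H> (delete_edges G F)"
      using del by (auto simp: deletable_def)
    have "card (nbrs G v - \<Union>F) < r"
      using few[OF G v _ F(1)] F(3) by (auto simp: free_of_iff)
    moreover have "finite (\<Union>F)"
      using finite_subset[of "\<Union>F" "verts G"] F(1) G(1) by (auto simp: simple_graph_def)
    then have "card (nbrs G v) - card (\<Union>F) \<le> card (nbrs G v - \<Union>F)" by (rule diff_card_le_card_Diff)
    moreover have "card (\<Union>F) \<le> 2 * k" using card_Union_edges_le[OF G(1) F(1)] F(2) by simp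
    ultimately show "card (nbrs G v) \<le> Suc r + 2 * k" by linarith
  qed simp
qed

section \<open>A fixed no-instance\<close>

lemma simple_complete_graph: "simple_graph (complete_graph m)"
  by (auto simp: simple_graph_def complete_graph_def)

text \<open>For \<open>s > 1\<close> the star has two leaves, and these are not adjacent.\<close>

lemma complete_graph_star_free:
  assumes "s > 1"
  shows "free_of {star_graph s} (complete_graph m)"
  unfolding free_of_def
proof clarsimp
  fix S assume S: "S \<subseteq> verts (complete_graph m)" "graph_iso (star_graph s) (induced_subgraph (complete_graph m) S)"
  obtain f where f: "bij_betw f {0..s} S"
    "(\<lambda>e. f ` e) ` edges (star_graph s) = {e \<in> edges (complete_graph m). e \<subseteq> S}"
    using S(2) by (auto elim!: graph_isoE simp: star_graph_def)
  have inj: "inj_on f {0..s}" using f(1) by (simp add: bij_betw_def)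
  then have ne: "f 1 \<noteq> f 2" using assms inj_onD[of f "{0..s}" 1 2] by auto
  have "f 1 \<in> S" "f 2 \<in> S" using f(1) assms by (auto simp: bij_betw_def)
  with ne S(1) have "{f 1, f 2} \<in> {e \<in> edges (complete_graph m). e \<subseteq> S}"
    by (auto simp: complete_graph_def)
  then obtain i where "f ` {1, 2} = f ` {0, i}" "i \<in> {1..s}"
    unfolding f(2)[symmetric] by (auto simp: star_graph_def)
  then have "{1, 2} = {0, i}" using inj_on_image_eq_iff[OF inj, of "{1, 2}" "{0, i}"] assms by auto
  then show False by (auto simp: doubleton_eq_iff)
qed

text \<open>A deleted edge has an endpoint \<open>y\<close>, and the \<open>t\<close> vertices other
  than \<open>y\<close> still form a complete graph. Instances need a positive parameter, which is
  why one deletion has to be survived.\<close>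

lemma complete_graph_not_deletable:
  assumes K: "\<exists>K\<in>\<H>. graph_iso (complete_graph t) K"
  shows "\<not> deletable \<H> (complete_graph (Suc t)) 1"
proof
  let ?G = "complete_graph (Suc t)"
  assume "deletable \<H> ?G 1"
  then obtain F where F: "F \<subseteq> edges ?G" "card F \<le> 1" "free_of \<H> (delete_edges ?G F)"
    by (auto simp: deletable_def)
  have finF: "finite F" using finite_subset[OF F(1) finite_edges[OF simple_complete_graph]] .
  obtain y where y: "y < Suc t" "\<And>e. e \<in> F \<Longrightarrow> y \<in> e"
  proof (cases "F = {}")
    case False
    with finF have "card F \<noteq> 0" by simp
    with F(2) have "card F = 1" by linarith
    then obtain e where e: "F = {e}" by (auto simp: card_1_singleton_iff)
    then have "e \<subseteq> {..<Suc t}" "card e = 2" using F(1) by (auto simp: complete_graph_def)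
    then obtain y where "y \<in> e" "y < Suc t" by (auto simp: card_2_iff)
    with e show ?thesis by (intro that[of y]) auto
  qed (use that[of 0] in auto)
  have "induced_copy \<H> (delete_edges ?G F) ({..<Suc t} - {y})"
  proof (rule clique_induced_copy[OF K])
    show "card ({..<Suc t} - {y}) = t" using y(1) by simp
    fix x z assume "x \<in> {..<Suc t} - {y}" "z \<in> {..<Suc t} - {y}" "x \<noteq> z"
    moreover have "{x, z} \<notin> F" using y(2)[of "{x, z}"] calculation by auto
    ultimately show "{x, z} \<in> edges (delete_edges ?G F)" by (auto simp: complete_graph_def)
  qed (auto simp: complete_graph_def)
  with F(3) show False by (simp add: free_of_iff)
qed

section \<open>Reading an encoded instance\<close>

definition adj :: "tree \<Rightarrow> nat \<Rightarrow> nat \<Rightarrow> bool" where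
  "adj x i j \<longleftrightarrow> left ((right ^^ j) (left ((right ^^ i) (right x)))) \<noteq> Leaf"

lemma ptest_adj: "polytime f \<Longrightarrow> polynat g \<Longrightarrow> polynat h \<Longrightarrow> ptest (\<lambda>x. adj (f x) (g x) (h x))"
  unfolding adj_def by (intro ptest_nonleaf polytime_left polytime_drop polytime_right)

lemma left_drop_enc_list: "i < length xs \<Longrightarrow> left ((right ^^ i) (enc_list xs)) = xs ! i"
proof (induction xs arbitrary: i)
  case (Cons a xs)
  then show ?case by (cases i) (auto simp del: funpow.simps(2) simp: funpow_Suc_right)
qed simp

lemma enc_instance_components:
  "len (left (enc_instance (G, k))) = k" "len (right (enc_instance (G, k))) = card (verts G)"
  by (simp_all add: enc_instance_def enc_graph_def len_def Let_def dec_list_enc_nat)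

lemma adj_enc_instance:
  assumes "i < card (verts G)" "j < card (verts G)"
  shows "adj (enc_instance (G, k)) i j \<longleftrightarrow> {i, j} \<in> edges G"
  using assms
  by (simp add: adj_def enc_instance_def enc_graph_def Let_def left_drop_enc_list enc_bool_def)

lemma size_enc_list_le:
  assumes "\<And>t. t \<in> set ts \<Longrightarrow> size t \<le> b"
  shows "size (enc_list ts) \<le> length ts * (b + 1)"
  using assms
proof (induction ts)
  case (Cons a ts)
  then have "size a \<le> b" "size (enc_list ts) \<le> length ts * (b + 1)" by auto
  then show ?case by simp
qed simp

text \<open>Converts bounds in the size of the input tree into bounds in \<open>n + k\<close>; the
  adjacency matrix accounts for the quadratic term.\<close>

lemma size_enc_instance_le:
  "size (enc_instance (G, k)) \<le> poly [:1, 2, 2:] (card (verts G) + k)"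
proof -
  let ?n = "card (verts G)"
  have "size (enc_graph G) \<le> ?n * (?n * 2 + 1)"
    unfolding enc_graph_def Let_def
    by (rule order_trans[OF size_enc_list_le[of _ "?n * 2"]])
       (auto intro!: order_trans[OF size_enc_list_le[of _ 1]] simp: enc_bool_def)
  also have "\<dots> \<le> (?n + k) * ((?n + k) * 2 + 1)" by (intro mult_le_mono add_mono) auto
  finally show ?thesis by (simp add: enc_instance_def algebra_simps)
qed

section \<open>Recognizing induced copies\<close>

lemma graph_isoI:
  assumes "simple_graph H" "simple_graph G" "bij_betw f (verts H) (verts G)"
    and "\<And>a b. a \<in> verts H \<Longrightarrow> b \<in> verts H \<Longrightarrow> a \<noteq> b \<Longrightarrow> {f a, f b} \<in> edges G \<longleftrightarrow> {a, b} \<in> edges H"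
  shows "graph_iso H G"
proof -
  have "(\<lambda>e. f ` e) ` edges H = edges G"
  proof (intro equalityI subsetI)
    fix e assume "e \<in> (\<lambda>e. f ` e) ` edges H"
    then obtain e' where e': "e' \<in> edges H" "e = f ` e'" by blast
    obtain a b where "e' = {a, b}" "a \<noteq> b" "a \<in> verts H" "b \<in> verts H"
      using edge_cases[OF assms(1) e'(1)] by metis
    with e' assms(4) show "e \<in> edges G" by auto
  next
    fix e assume e: "e \<in> edges G"
    obtain x y where xy: "e = {x, y}" "x \<noteq> y" "x \<in> verts G" "y \<in> verts G"
      using edge_cases[OF assms(2) e] by metis
    then obtain a b where ab: "x = f a" "y = f b" "a \<in> verts H" "b \<in> verts H"
      using assms(3) unfolding bij_betw_def by blast
    then have "{a, b} \<in> edges H" using assms(4) e xy by auto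
    moreover have "e = f ` {a, b}" using xy ab by simp
    ultimately show "e \<in> (\<lambda>e. f ` e) ` edges H" by blast
  qed
  with assms(3) show ?thesis unfolding graph_iso_def by blast
qed

lemma simple_induced_subgraph: "simple_graph G \<Longrightarrow> S \<subseteq> verts G \<Longrightarrow> simple_graph (induced_subgraph G S)"
  using finite_subset by (auto simp: simple_graph_def)

text \<open>Replaces the search over vertex sets by a search over tuples of constant length
  \<open>m\<close>, of which there are polynomially many. \<open>h\<close> fixes the order in which
  a tuple lists the image of \<open>H\<close>.\<close>

lemma graph_iso_induced_iff_tuple:
  assumes H: "simple_graph H" and G: "simple_graph G" and h: "bij_betw h {..<m} (verts H)"
  shows "(\<exists>S\<subseteq>verts G. v \<in> S \<and> graph_iso H (induced_subgraph G S)) \<longleftrightarrow>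
    (\<exists>vs. length vs = m \<and> set vs \<subseteq> verts G \<and>
      (\<forall>i<m. \<forall>j<m. i \<noteq> j \<longrightarrow> vs ! i \<noteq> vs ! j \<and>
        ({vs ! i, vs ! j} \<in> edges G \<longleftrightarrow> {h i, h j} \<in> edges H)) \<and> (\<exists>i<m. vs ! i = v))"
    (is "?L \<longleftrightarrow> (\<exists>vs. ?R vs)")
proof
  assume ?L
  then obtain S f where S: "S \<subseteq> verts G" "v \<in> S" and f: "bij_betw f (verts H) S"
    "(\<lambda>e. f ` e) ` edges H = {e \<in> edges G. e \<subseteq> S}" by (auto elim!: graph_isoE)
  have fh: "bij_betw (\<lambda>i. f (h i)) {..<m} S" using bij_betw_trans[OF h f(1)] by (simp add: comp_def)
  have hV: "h i \<in> verts H" if "i < m" for i using h that by (auto simp: bij_betw_def)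
  have fS: "f (h i) \<in> S" if "i < m" for i using fh that by (auto simp: bij_betw_def)
  let ?vs = "map (\<lambda>i. f (h i)) [0..<m]"
  have "?R ?vs"
  proof (intro conjI allI impI)
    show "set ?vs \<subseteq> verts G" using fS S(1) by auto
    have "v \<in> (\<lambda>i. f (h i)) ` {..<m}" using fh S(2) by (simp add: bij_betw_def)
    then show "\<exists>i<m. ?vs ! i = v" by auto
    fix i j assume ij: "i < m" "j < m" "i \<noteq> j"
    then have "f (h i) \<noteq> f (h j)" using fh by (auto simp: bij_betw_def inj_on_def)
    then show "?vs ! i \<noteq> ?vs ! j" using ij by simp
    have "{f (h i), f (h j)} \<in> edges G \<longleftrightarrow> f ` {h i, h j} \<in> (\<lambda>e. f ` e) ` edges H"
      using f(2) fS ij by auto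
    also have "\<dots> \<longleftrightarrow> {h i, h j} \<in> edges H"
    proof
      assume "f ` {h i, h j} \<in> (\<lambda>e. f ` e) ` edges H"
      then obtain e where e: "e \<in> edges H" "f ` {h i, h j} = f ` e" by blast
      have "e \<subseteq> verts H" using H e(1) by (simp add: simple_graph_def)
      moreover have "{h i, h j} \<subseteq> verts H" using hV ij by simp
      ultimately have "{h i, h j} = e"
        using e(2) f(1) inj_on_image_eq_iff[of f "verts H" "{h i, h j}" e] by (simp add: bij_betw_def)
      with e(1) show "{h i, h j} \<in> edges H" by simp
    qed blast
    finally show "{?vs ! i, ?vs ! j} \<in> edges G \<longleftrightarrow> {h i, h j} \<in> edges H" using ij by simp
  qed simp
  then show "\<exists>vs. ?R vs" ..
next
  assume "\<exists>vs. ?R vs"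
  then obtain vs where vs: "?R vs" ..
  let ?g = "inv_into {..<m} h"
  have g: "bij_betw ?g (verts H) {..<m}" using bij_betw_inv_into[OF h] .
  have gm: "?g a < m" "h (?g a) = a" if "a \<in> verts H" for a
    using g h that f_inv_into_f[of a h "{..<m}"] by (auto simp: bij_betw_def)
  have "inj_on (\<lambda>i. vs ! i) {..<m}" using vs by (auto simp: inj_on_def)
  moreover have "(\<lambda>i. vs ! i) ` {..<m} = set vs" using vs by (auto simp: set_conv_nth)
  ultimately have "bij_betw (\<lambda>i. vs ! i) {..<m} (set vs)" by (simp add: bij_betw_def)
  from bij_betw_trans[OF g this] have bij: "bij_betw (\<lambda>a. vs ! ?g a) (verts H) (set vs)"
    by (simp add: comp_def)
  have "graph_iso H (induced_subgraph G (set vs))"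
  proof (rule graph_isoI[OF H])
    show "simple_graph (induced_subgraph G (set vs))" using simple_induced_subgraph[OF G] vs by blast
    show "bij_betw (\<lambda>a. vs ! ?g a) (verts H) (verts (induced_subgraph G (set vs)))" using bij by simp
    fix a b assume ab: "a \<in> verts H" "b \<in> verts H" "a \<noteq> b"
    then have "?g a \<noteq> ?g b" using gm(2) by metis
    then have "{vs ! ?g a, vs ! ?g b} \<in> edges G \<longleftrightarrow> {a, b} \<in> edges H"
      using vs gm ab by auto
    then show "{vs ! ?g a, vs ! ?g b} \<in> edges (induced_subgraph G (set vs)) \<longleftrightarrow> {a, b} \<in> edges H"
      using gm(1) ab vs by auto
  qed
  moreover have "v \<in> set vs" "set vs \<subseteq> verts G" using vs by auto
  ultimately show ?L by blast
qed

text \<open>Polynomial time is required on all trees, correctness only on codes of simple graphs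
  with vertex set \<open>{..<n}\<close>.\<close>

definition vertex_test :: "(nat sgraph \<Rightarrow> nat set) \<Rightarrow> (tree \<Rightarrow> nat \<Rightarrow> bool) \<Rightarrow> bool" where
  "vertex_test X T \<longleftrightarrow> ptest (\<lambda>y. T (left y) (len (right y))) \<and>
     (\<forall>G k v. simple_graph G \<longrightarrow> (\<exists>n. verts G = {..<n}) \<longrightarrow> v \<in> verts G \<longrightarrow>
        (T (enc_instance (G, k)) v \<longleftrightarrow> v \<in> X G))"

lemma vertex_test_single_copy:
  assumes "simple_graph H"
  obtains T where "vertex_test (copy_verts {H}) T"
proof -
  obtain h where h: "bij_betw h {..<card (verts H)} (verts H)"
    using assms finite_same_card_bij[of "{..<card (verts H)}" "verts H"] by (auto simp: simple_graph_def)
  let ?m = "card (verts H)"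
  \<comment> \<open>\<open>H\<close> is fixed, so the quantifiers over \<open>i\<close> and
    \<open>j\<close> unroll into a constant number of tests, and adjacency in \<open>H\<close> is a
    constant in each; only the vertices \<open>e i\<close> vary.\<close>
  let ?P = "\<lambda>x v e. (\<forall>i<?m. \<forall>j<?m. i \<noteq> j \<longrightarrow> \<not> e i = e j \<and>
    (adj x (e i) (e j) \<longleftrightarrow> {h i, h j} \<in> edges H)) \<and> (\<exists>i<?m. e i = v)"
  let ?env = "\<lambda>t i. len (left ((right ^^ i) t))"
  let ?T = "\<lambda>x v. \<exists>vs. length vs = ?m \<and> set vs \<subseteq> {..<len (right x)} \<and>
    ?P x v (?env (enc_list (map enc_nat vs)))"
  have "ptest (\<lambda>y. ?P (left (left y)) (len (right (left y))) (?env (right y)))"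
    by (intro ptest_conj ptest_all_const ptest_ex_const ptest_imp ptest_iff ptest_not ptest_eq ptest_adj
        ptest_const polynat_len polytime_left polytime_right polytime_id polytime_drop polynat_const)
  then have "ptest (\<lambda>y. ?T (left y) (len (right y)))"
    by (rule ptest_ex_tuple) (intro polynat_len polytime_right polytime_left polytime_id)
  moreover have "?T (enc_instance (G, k)) v \<longleftrightarrow> v \<in> copy_verts {H} G"
    if G: "simple_graph G" "verts G = {..<n}" for G n k v
  proof -
    have "?P (enc_instance (G, k)) v (?env (enc_list (map enc_nat vs))) \<longleftrightarrow>
        (\<forall>i<?m. \<forall>j<?m. i \<noteq> j \<longrightarrow> vs ! i \<noteq> vs ! j \<and>
        ({vs ! i, vs ! j} \<in> edges G \<longleftrightarrow> {h i, h j} \<in> edges H)) \<and> (\<exists>i<?m. vs ! i = v)"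
      if vs: "length vs = ?m" "set vs \<subseteq> verts G" for vs
    proof -
      have env: "?env (enc_list (map enc_nat vs)) i = vs ! i" if "i < ?m" for i
        using that vs(1) by (simp add: left_drop_enc_list)
      have "adj (enc_instance (G, k)) (vs ! i) (vs ! j) \<longleftrightarrow> {vs ! i, vs ! j} \<in> edges G"
        if "i < ?m" "j < ?m" for i j
      proof -
        have "vs ! i \<in> verts G" "vs ! j \<in> verts G" using vs that by auto
        then show ?thesis using G(2) by (simp add: adj_enc_instance)
      qed
      then show ?thesis using env by (simp cong: conj_cong)
    qed
    then have "?T (enc_instance (G, k)) v \<longleftrightarrow> (\<exists>vs. length vs = ?m \<and> set vs \<subseteq> verts G \<and>
      (\<forall>i<?m. \<forall>j<?m. i \<noteq> j \<longrightarrow> vs ! i \<noteq> vs ! j \<and>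
        ({vs ! i, vs ! j} \<in> edges G \<longleftrightarrow> {h i, h j} \<in> edges H)) \<and> (\<exists>i<?m. vs ! i = v))"
      using G(2) by (simp add: enc_instance_components cong: conj_cong)
    also have "\<dots> \<longleftrightarrow> v \<in> copy_verts {H} G"
      unfolding graph_iso_induced_iff_tuple[OF assms G(1) h, symmetric]
      by (auto simp: copy_verts_def induced_copy_def)
    finally show ?thesis .
  qed
  ultimately show ?thesis using that[of ?T] unfolding vertex_test_def by blast
qed

lemma vertex_test_copies:
  assumes "finite \<H>" "\<And>H. H \<in> \<H> \<Longrightarrow> simple_graph H"
  obtains T where "vertex_test (copy_verts \<H>) T"
  using assms
proof (induction \<H> arbitrary: thesis rule: finite_induct)
  case empty
  show ?case
    by (rule empty(1)[of "\<lambda>_ _. False"])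
       (auto simp: vertex_test_def copy_verts_def induced_copy_def ptest_const)
next
  case (insert H \<H>)
  obtain T where T: "vertex_test (copy_verts \<H>) T" using insert.IH insert.prems(2) by blast
  obtain T' where T': "vertex_test (copy_verts {H}) T'"
    using vertex_test_single_copy insert.prems(2) by blast
  have "copy_verts (insert H \<H>) G = copy_verts {H} G \<union> copy_verts \<H> G" for G :: "nat sgraph"
    by (auto simp: copy_verts_def induced_copy_def)
  then have "vertex_test (copy_verts (insert H \<H>)) (\<lambda>x v. T' x v \<or> T x v)"
    using T T' unfolding vertex_test_def by (auto intro!: ptest_disj)
  then show ?case by (rule insert.prems(1))
qed

section \<open>The kernelization algorithm\<close>

text \<open>Filtering the list of all vertices, instead of appending neighbours to \<open>W\<close>,
  keeps the result free of repetitions and of bounded size whatever \<open>W\<close> is. Logarithmic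
  iteration relies on this.\<close>

definition expand :: "tree \<Rightarrow> nat list \<Rightarrow> nat list" where
  "expand x W = filter (\<lambda>v. (\<exists>w\<in>set W. w = v) \<or> (\<exists>w\<in>set W. adj x v w)) (rev [0..<len (right x)])"

lemma polynats_expand:
  assumes "polytime g" "polynats f"
  shows "polynats (\<lambda>y. expand (g y) (f y))"
proof -
  have left: "polynats (\<lambda>z. f (left z))"
    by (intro polynats_comp[OF assms(2)] polytime_left polytime_id)
  have g: "polytime (\<lambda>u. g (left (left u)))"
    by (intro polytime_comp[OF assms(1)] polytime_left polytime_id)
  show ?thesis
    unfolding expand_def using assms(1)
    by (intro polynats_filter polynats_upt polynat_len polytime_right ptest_disj ptest_bex_nats left
        ptest_eq ptest_adj g polytime_id polytime_left)
qed

lemma polynats_expand_funpow: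
  "polytime g \<Longrightarrow> polynats f \<Longrightarrow> polynats (\<lambda>y. (expand (g y) ^^ c) (f y))"
  by (induction c) (auto intro: polynats_expand)

lemma expand_enc_instance:
  assumes "verts G = {..<n}" "set W \<subseteq> verts G"
  shows "set (expand (enc_instance (G, k)) W) = nbhd G (set W)"
  using assms adj_enc_instance[of _ G _ k]
  by (auto simp: expand_def nbhd_def enc_instance_components subset_iff)

lemma expand_funpow_enc_instance:
  assumes "verts G = {..<n}" "set W \<subseteq> verts G"
  shows "set ((expand (enc_instance (G, k)) ^^ c) W) = ball G c (set W)"
proof (induction c)
  case (Suc c)
  with ball_subset_verts[OF assms(2), where i = c] show ?case
    by (simp add: expand_enc_instance[OF assms(1)])
qed simp

lemma distinct_expand: "distinct (expand x W)"
  by (simp add: expand_def)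

lemma size_expand_le: "size (enc_list (map enc_nat (expand x W))) \<le> poly [:0, 1, 1:] (size x)"
proof -
  let ?n = "len (right x)"
  have "size (enc_list (map enc_nat (expand x W))) \<le> length (expand x W) * (?n + 1)"
    by (rule order_trans[OF size_enc_list_le[of _ ?n]]) (auto simp: expand_def)
  also have "\<dots> \<le> ?n * (?n + 1)"
    unfolding expand_def using length_filter_le[of _ "rev [0..<?n]"] by (intro mult_right_mono) auto
  also have "?n \<le> size x" using len_le_size[of "right x"] size_right_le[of x] by simp
  then have "?n * (?n + 1) \<le> size x * (size x + 1)" by (intro mult_le_mono) auto
  finally show ?thesis by (simp add: algebra_simps)
qed

text \<open>\<open>Suc c\<close> will be the width \<open>2 * D * d\<close> of one halving, and
  \<open>Suc d\<close> joins the initial radius 1 with the final margin \<open>d\<close>. As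
  successors they make every block end with an \<open>expand\<close>, whose size bound holds for any
  list.\<close>

definition kernel_verts :: "(tree \<Rightarrow> nat \<Rightarrow> bool) \<Rightarrow> nat \<Rightarrow> nat \<Rightarrow> tree \<Rightarrow> nat list" where
  "kernel_verts T c d x = (expand x ^^ Suc d)
     (((expand x ^^ Suc c) ^^ bit_length (len (left x))) (filter (T x) (rev [0..<len (right x)])))"

lemma polynats_kernel_verts:
  assumes "ptest (\<lambda>y. T (left y) (len (right y)))"
  shows "polynats (kernel_verts T c d)"
  unfolding kernel_verts_def[abs_def]
proof (rule polynats_expand_funpow[OF polytime_id], rule polynats_funpow_bit_length)
  show "polynats (\<lambda>y. (expand (left y) ^^ Suc c) (lens (right y)))"
    by (intro polynats_expand_funpow polynats_lens polytime_left polytime_right polytime_id)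
  show "size (enc_list (map enc_nat ((expand x ^^ Suc c) W))) \<le> poly [:0, 1, 1:] (size x)" for x W
    using size_expand_le by simp
  show "polynats (\<lambda>x. filter (T x) (rev [0..<len (right x)]))"
    by (intro polynats_filter[OF assms] polynats_upt polynat_len polytime_right polytime_id)
qed (intro polynat_len polytime_left polytime_id)

lemma kernel_verts_enc_instance:
  assumes "vertex_test X T" "simple_graph G" "verts G = {..<n}" "X G \<subseteq> verts G"
  shows "set (kernel_verts T c d (enc_instance (G, k))) =
      ball G (1 + Suc c * bit_length k + d) (X G)"
    and "distinct (kernel_verts T c d (enc_instance (G, k)))"
proof -
  let ?x = "enc_instance (G, k)"
  let ?X = "filter (T ?x) (rev [0..<n])"
  have X: "set ?X = X G" using assms by (auto simp: vertex_test_def)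
  have "((expand ?x ^^ Suc c) ^^ m) ?X = (expand ?x ^^ (Suc c * m)) ?X" for m
    by (simp only: funpow_mult mult.commute)
  then have "kernel_verts T c d ?x = (expand ?x ^^ (Suc d + Suc c * bit_length k)) ?X"
    using assms(3) unfolding kernel_verts_def enc_instance_components funpow_add by simp
  moreover have eq: "Suc d + Suc c * bit_length k = 1 + Suc c * bit_length k + d" by simp
  ultimately show "set (kernel_verts T c d ?x) = ball G (1 + Suc c * bit_length k + d) (X G)"
    using expand_funpow_enc_instance[OF assms(3), of ?X "Suc d + Suc c * bit_length k" k] X assms(4)
    by (simp only: eq)
  show "distinct (kernel_verts T c d ?x)"
    unfolding kernel_verts_def by (simp add: distinct_expand)
qed

text \<open>Instances must have a vertex set \<open>{..<n}\<close>, so each kernel vertex is renamed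
  to its position in \<open>W\<close>.\<close>

definition relabelled :: "nat sgraph \<Rightarrow> nat list \<Rightarrow> nat sgraph" where
  "relabelled G W = \<lparr>verts = {..<length W},
     edges = {{i, j} | i j. i < length W \<and> j < length W \<and> {W ! i, W ! j} \<in> edges G}\<rparr>"

lemma edge_relabelled_iff:
  assumes "i < length W" "j < length W"
  shows "{i, j} \<in> edges (relabelled G W) \<longleftrightarrow> {W ! i, W ! j} \<in> edges G"
  using assms by (auto simp: relabelled_def doubleton_eq_iff insert_commute)

lemma simple_relabelled:
  assumes "simple_graph G"
  shows "simple_graph (relabelled G W)"
proof -
  have "i \<noteq> j" if "{W ! i, W ! j} \<in> edges G" for i j
    using not_in_nbrs[OF assms, of "W ! i"] that by (auto simp: nbrs_def)
  then show ?thesis by (auto simp: simple_graph_def relabelled_def card_insert_if)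
qed

lemma graph_iso_relabelled:
  assumes "simple_graph G" "distinct W" "set W \<subseteq> verts G"
  shows "graph_iso (relabelled G W) (induced_subgraph G (set W))"
proof (rule graph_isoI[OF simple_relabelled[OF assms(1)] simple_induced_subgraph[OF assms(1,3)]])
  show "bij_betw (\<lambda>i. W ! i) (verts (relabelled G W)) (verts (induced_subgraph G (set W)))"
    using bij_betw_nth[OF assms(2), of "{..<length W}" "set W"] by (simp add: relabelled_def)
qed (auto simp: relabelled_def[THEN arg_cong[where f = verts]] edge_relabelled_iff)

definition encode_relabelled :: "tree \<Rightarrow> nat list \<Rightarrow> tree" where
  "encode_relabelled x W = enc_list (map (\<lambda>i. enc_list (map (\<lambda>j. enc_bool (adj x i j)) W)) W)"

lemma polytime_encode_relabelled:
  assumes "polynats f"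
  shows "polytime (\<lambda>x. encode_relabelled x (f x))"
proof -
  have "polynats (\<lambda>y. f (left y))"
    by (intro polynats_comp[OF assms] polytime_left polytime_id)
  then have "polylist (\<lambda>y. map (\<lambda>j. enc_bool (adj (left y) (len (right y)) j)) (f (left y)))"
    by (intro polylist_map_nats)
       (auto simp flip: ptest_def intro!: ptest_adj polynat_len polytime_left polytime_right polytime_id)
  then show ?thesis
    unfolding encode_relabelled_def polylist_def[symmetric]
    by (intro polylist_map_nats assms) (simp add: polylist_def)
qed

lemma encode_relabelled_enc_instance:
  assumes "verts G = {..<n}" "set W \<subseteq> verts G"
  shows "encode_relabelled (enc_instance (G, k)) W = enc_graph (relabelled G W)"
proof -
  have *: "map f W = map (\<lambda>i. f (W ! i)) [0..<length W]" for f :: "nat \<Rightarrow> tree"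
    by (rule nth_equalityI) auto
  have "adj (enc_instance (G, k)) (W ! i) (W ! j) \<longleftrightarrow> {i, j} \<in> edges (relabelled G W)"
    if "i < length W" "j < length W" for i j
    using that assms adj_enc_instance[of "W ! i" G "W ! j" k] nth_mem[of i W] nth_mem[of j W]
    by (simp add: edge_relabelled_iff subset_iff)
  then show ?thesis
    by (auto simp: encode_relabelled_def enc_graph_def * Let_def
        relabelled_def[THEN arg_cong[where f = verts]] intro!: arg_cong[where f = enc_list])
qed

section \<open>From polynomial-time functions to kernelizations\<close>

lemma polytime_computes:
  assumes "polytime f"
  obtains c p where "\<And>x. \<exists>\<tau>. computes c x \<tau> (f x) \<and> \<tau> \<le> poly p (size x)"
proof -
  obtain c N p where c: "runs c N f p" using assms by (auto simp: polytime_def)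
  have "\<exists>\<tau>. computes c x \<tau> (f x) \<and> \<tau> \<le> poly p (size x)" for x
  proof -
    define \<sigma> :: state where "\<sigma> = (\<lambda>_. Leaf)(0 := x)"
    obtain \<tau> \<sigma>' where "exec c \<sigma> \<tau> \<sigma>'" "\<sigma>' 0 = f (\<sigma> 0)" "\<tau> \<le> poly p (size (\<sigma> 0))"
      using runsE[OF c, of \<sigma>] by blast
    moreover have "\<sigma> 0 = x" by (simp add: \<sigma>_def)
    ultimately show ?thesis unfolding computes_def \<sigma>_def by auto
  qed
  with that show ?thesis by blast
qed

lemma polynomial_kernelizationI:
  assumes "polytime f"
    and "\<And>G k. valid (G, k) \<Longrightarrow> \<exists>G' k'. f (enc_instance (G, k)) = enc_instance (G', k') \<and>
      valid (G', k') \<and> instance_size (G', k') \<le> poly q k \<and> (yes (G', k') \<longleftrightarrow> yes (G, k))"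
  shows "admits_polynomial_kernelization valid yes"
proof -
  obtain c p where c: "\<And>x. \<exists>\<tau>. computes c x \<tau> (f x) \<and> \<tau> \<le> poly p (size x)"
    using polytime_computes[OF assms(1)] by blast
  have "\<exists>G' k' \<tau>. computes c (enc_instance (G, k)) \<tau> (enc_instance (G', k')) \<and>
      \<tau> \<le> poly (pcompose p [:1, 2, 2:]) (card (verts G) + k) \<and> valid (G', k') \<and>
      instance_size (G', k') \<le> poly q k \<and> (yes (G', k') \<longleftrightarrow> yes (G, k))" if valid: "valid (G, k)" for G k
  proof -
    obtain G' k' where G': "f (enc_instance (G, k)) = enc_instance (G', k')" "valid (G', k')"
      "instance_size (G', k') \<le> poly q k" "yes (G', k') \<longleftrightarrow> yes (G, k)"
      using assms(2)[OF valid] by blast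
    obtain \<tau> where \<tau>: "computes c (enc_instance (G, k)) \<tau> (f (enc_instance (G, k)))"
      "\<tau> \<le> poly p (size (enc_instance (G, k)))" using c by blast
    have "\<tau> \<le> poly (pcompose p [:1, 2, 2:]) (card (verts G) + k)"
      unfolding poly_pcompose using \<tau>(2) poly_nat_mono[OF size_enc_instance_le] by (rule order_trans)
    with \<tau>(1) G' show ?thesis by (intro exI[of _ G'] exI[of _ k'] exI[of _ \<tau>]) simp
  qed
  then show ?thesis
    unfolding admits_polynomial_kernelization_def polynomial_kernelization_def by blast
qed

lemma card_edges_le:
  assumes "simple_graph G"
  shows "card (edges G) \<le> card (verts G) * card (verts G)"
proof -
  have fin: "finite (verts G)" using assms by (simp add: simple_graph_def)
  have "edges G \<subseteq> (\<lambda>(a, b). {a, b}) ` (verts G \<times> verts G)"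
  proof
    fix e assume "e \<in> edges G"
    then obtain a b where "e = {a, b}" "a \<in> verts G" "b \<in> verts G" using edge_cases[OF assms] by metis
    then show "e \<in> (\<lambda>(a, b). {a, b}) ` (verts G \<times> verts G)" by auto
  qed
  then have "card (edges G) \<le> card (verts G \<times> verts G)" using fin by (intro surj_card_le) auto
  then show ?thesis by (simp add: card_cartesian_product)
qed

theorem theorem3:
  fixes \<H> :: "'a sgraph set" and s t :: nat
  assumes "finite \<H>"
    and "\<And>H. H \<in> \<H> \<Longrightarrow> simple_graph H \<and> connected_graph H"
    and "t > 2"
    and "\<exists>K\<in>\<H>. graph_iso (complete_graph t) K"
    and "s > 1"
  shows "admits_polynomial_kernelization (deletion_instance s) (deletion_yes \<H>)"
proof -
  \<comment> \<open>The sum bounds the order of every member at once; the successor makes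
    \<open>2 * D * d\<close> positive, so that it has the form \<open>Suc c\<close>.\<close>
  define d where "d = Suc (\<Sum>H\<in>\<H>. card (verts H))"
  interpret connected_family \<H> d
  proof
    fix H assume "H \<in> \<H>"
    then have "card (verts H) \<le> (\<Sum>H\<in>\<H>. card (verts H))"
      using assms(1) member_le_sum[of H \<H> "\<lambda>H. card (verts H)"] by simp
    then show "card (verts H) \<le> d" by (simp add: d_def)
  qed (use assms(2) in auto)
  obtain D where D: "D > 0"
    "\<And>(G :: nat sgraph) v. simple_graph G \<Longrightarrow> free_of {star_graph s} G \<Longrightarrow> v \<in> verts G - copy_verts \<H> G \<Longrightarrow>
      card (nbrs G v) \<le> D"
    "\<And>(G :: nat sgraph) k v. simple_graph G \<Longrightarrow> free_of {star_graph s} G \<Longrightarrow> deletable \<H> G k \<Longrightarrow> v \<in> verts G \<Longrightarrow>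
      card (nbrs G v) \<le> D + 2 * k"
    using degree_bounds[OF assms(4), of s] assms(3) by auto
  obtain T where T: "vertex_test (copy_verts \<H>) T"
    using vertex_test_copies[OF assms(1)] assms(2) by blast
  obtain c where c: "2 * D * d = Suc c" using D(1) by (cases "2 * D * d") (auto simp: d_def)
  \<comment> \<open>The bound of \<open>card_kernel_le\<close> with \<open>M = D + 2 * k\<close>,
    read as a polynomial in \<open>k\<close>.\<close>
  define B :: "nat poly" where
    "B = [:1 + D:] ^ d * [:1, 2:] ^ (D * Suc c) * ([:1 + D, 2:] * ([:1 + D, 2:] ^ d * [:0, 2:]))"
  define W where "W = kernel_verts T c d"
  define no where "no = enc_instance (complete_graph (Suc t), 1)"
  define f where "f x = (if length (W x) \<le> poly B (len (left x))
    then Node (enc_nat (len (left x))) (encode_relabelled x (W x)) else no)" for x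
  have yes: "deletion_yes \<H> (G, k) \<longleftrightarrow> deletable \<H> G k" for G k
    by (simp add: deletion_yes_def deletable_def)
  show ?thesis
  proof (rule polynomial_kernelizationI)
    have "polynats W"
      using T unfolding W_def vertex_test_def by (intro polynats_kernel_verts) blast
    then show "polytime f"
      unfolding f_def[abs_def]
      by (intro polytime_if ptest_le polynats_length polynat_poly polynat_len polytime_left polytime_id
          polytime_Node polytime_encode_relabelled polytime_const polynat_len[unfolded polynat_def])
  next
    fix G k assume "deletion_instance s (G, k)"
    then obtain n where G: "simple_graph G" "verts G = {..<n}" "free_of {star_graph s} G" "k > 0"
      by (auto simp: deletion_instance_def)
    \<comment> \<open>\<open>B\<close> and \<open>B * B\<close> bound the vertices and edges of the
      kernel; the linear polynomial adds \<open>k\<close> and pays for the fixed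
      no-instance.\<close>
    let ?x = "enc_instance (G, k)" and ?q = "B + B * B + [:Suc t + Suc t * Suc t + 1, 1:]"
    have setW: "set (W ?x) = ball G (1 + 2 * D * d * bit_length k + d) (copy_verts \<H> G)"
      and distinct: "distinct (W ?x)"
      using kernel_verts_enc_instance[OF T G(1,2) copy_verts_subset, of c d k] by (simp_all add: W_def c)
    have WG: "set (W ?x) \<subseteq> verts G" unfolding setW by (rule ball_subset_verts[OF copy_verts_subset])
    let ?G' = "relabelled G (W ?x)"
    have G': "simple_graph ?G'" using simple_relabelled[OF G(1)] .
    have iso: "graph_iso ?G' (induced_subgraph G (set (W ?x)))"
      using graph_iso_relabelled[OF G(1) distinct WG] .
    have iso': "graph_iso (induced_subgraph G (set (W ?x))) ?G'"
      using iso by (rule graph_iso_sym) (use G' in \<open>auto simp: simple_graph_def\<close>)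
    have vG': "verts ?G' = {..<length (W ?x)}" by (simp add: relabelled_def)
    show "\<exists>G' k'. f ?x = enc_instance (G', k') \<and> deletion_instance s (G', k') \<and>
      instance_size (G', k') \<le> poly ?q k \<and> (deletion_yes \<H> (G', k') \<longleftrightarrow> deletion_yes \<H> (G, k))"
    proof (cases "length (W ?x) \<le> poly B k")
      case True
      have "f ?x = enc_instance (?G', k)"
        using True encode_relabelled_enc_instance[OF G(2) WG, of k]
        by (simp add: f_def enc_instance_components) (simp add: enc_instance_def)
      moreover have "free_of {star_graph s} ?G'"
        by (rule free_of_graph_iso[OF iso' _ free_of_induced_subgraph[OF WG G(3)]]) auto
      then have "deletion_instance s (?G', k)"
        using G' G(4) vG' by (auto simp: deletion_instance_def)
      moreover have "instance_size (?G', k) \<le> poly ?q k"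
      proof -
        have "card (edges ?G') \<le> poly B k * poly B k"
          using card_edges_le[OF G'] True mult_le_mono[OF True True] by (simp add: vG')
        then show ?thesis using True by (simp add: instance_size_def vG')
      qed
      moreover have "deletable \<H> ?G' k \<longleftrightarrow> deletable \<H> G k"
        using deletable_graph_iso[OF iso G'] deletable_graph_iso[OF iso' simple_induced_subgraph[OF G(1) WG]]
          deletable_kernel[OF G(1) setW D(2)[OF G(1,3)] D(1)] by blast
      ultimately show ?thesis unfolding yes by blast
    next
      case False
      have "\<not> deletable \<H> G k"
      proof
        assume del: "deletable \<H> G k"
        have "length (W ?x) = card (set (W ?x))" using distinct by (simp add: distinct_card)
        also have "\<dots> \<le> (1 + D) ^ d * (2 * k + 1) ^ (D * Suc c) *
            ((1 + (D + 2 * k)) * ((1 + (D + 2 * k)) ^ d * (2 * k)))"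
          unfolding setW c
          by (rule card_kernel_le[OF G(1) del D(2)[OF G(1,3)] D(3)[OF G(1,3) del]])
        also have "\<dots> = poly B k"
        proof -
          have "poly [:1 + D:] k = 1 + D" "poly [:1, 2:] k = 2 * k + 1"
            "poly [:1 + D, 2:] k = 1 + (D + 2 * k)" "poly [:0, 2:] k = 2 * k" by simp_all
          then show ?thesis by (simp only: B_def poly_mult poly_power)
        qed
        finally show False using False by simp
      qed
      moreover have "\<not> deletable \<H> (complete_graph (Suc t)) 1"
        by (rule complete_graph_not_deletable[OF assms(4)])
      moreover have "f ?x = enc_instance (complete_graph (Suc t), 1)"
        using False by (simp add: f_def enc_instance_components no_def)
      moreover have "deletion_instance s (complete_graph (Suc t), 1)"
        using complete_graph_star_free[OF assms(5)] simple_complete_graph[of "Suc t"]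
        by (auto simp: deletion_instance_def complete_graph_def)
      moreover have "instance_size (complete_graph (Suc t), 1) \<le> poly ?q k"
        using card_edges_le[OF simple_complete_graph[of "Suc t"]]
        by (simp add: instance_size_def complete_graph_def)
      ultimately show ?thesis unfolding yes by blast
    qed
  qed
qed

end
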